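(* There are absolute constants $\epsilon_0>0$ and $c>0$ such that for all $0<\epsilon<\epsilon_0$ and all integers $n\ge 2$, the class $\mathcal{L}_n$ of halfspaces over $\mathbb{R}^n$ satisfies $$m^{\mathrm{test}}_\epsilon(\mathcal{L}_n)\ge c\cdot\frac{n}{\log n}\qquad\text{and}\qquad q^{\mathrm{test}}_{0,\epsilon}(\mathcal{L}_n)\ge c\cdot\frac{n}{\log n}.$$
   Context: A halfspace is a function $f:\mathbb{R}^n\to\{\pm1\}$ of the form $f(x)=\mathrm{sign}(w_0+\sum_{i=1}^n w_ix_i)$ with $w_0,\dots,w_n\in\mathbb{R}$, where $\mathrm{sign}(z)=1$ for $z\ge0$ and $-1$ otherwise; $\mathcal{L}_n$ is the class of halfspaces. For a class $\mathcal{H}$ of two-valued functions on $\mathcal{X}$ (here with values in $\{\pm1\}$) and a probability distribution $\mathcal{D}$ on $\mathcal{X}$, $\mathrm{dist}_{\mathcal{D}}(f,g)=\Pr_{x\sim\mathcal{D}}[f(x)\ne g(x)]$ and $\mathrm{dist}_{\mathcal{D}}(f,\mathcal{H})=\inf_{h\in\mathcal{H}}\mathrm{dist}_{\mathcal{D}}(f,h)$. All testers are computationally unbounded randomized algorithms that must work for every unknown distribution $\mathcal{D}$ (all finitely supported distributions are allowed) and every unknown two-valued function $f$ on $\mathcal{X}$. (i) $m^{\mathrm{test}}_\epsilon(\mathcal{H})$ is the minimum $m$ such that some algorithm receiving $m$ labelled examples $(x,f(x))$, $x\sim\mathcal{D}$ independently, accepts with probability $\ge 2/3$ if $f\in\mathcal{H}$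 and rejects with probability $\ge2/3$ if $\mathrm{dist}_{\mathcal{D}}(f,\mathcal{H})\ge\epsilon$. (ii) $q^{\mathrm{test}}_{0,\epsilon}(\mathcal{H})$ is the minimum $q$ such that some algorithm making in total at most $q$ adaptive queries to $f$ at arbitrary points of $\mathcal{X}$ and independent labelled samples $(x,f(x))$, $x\sim\mathcal{D}$, accepts with probability $\ge2/3$ if $\mathrm{dist}_{\mathcal{D}}(f,\mathcal{H})=0$ and rejects with probability $\ge2/3$ if $\mathrm{dist}_{\mathcal{D}}(f,\mathcal{H})\ge\epsilon$. *)

theory Defs
  imports "HOL-Probability.Probability"
begin

text \<open>
  The domain \<open>\<X>\<close> is a measurable space \<open>X\<close>. Its distributions are the probability measures on
  the sigma-algebra of \<open>X\<close>, which is Borel in the case of interest. Two-valued functions are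
  measurable, so that disagreement and verdict probabilities are defined for every distribution,
  and extensional, so that equality of functions is equality on \<open>\<X>\<close>.
\<close>

definition distributions :: "'x measure \<Rightarrow> 'x measure set" where
  "distributions X = {D. prob_space D \<and> sets D = sets X}"

definition labellings :: "'x measure \<Rightarrow> ('x \<Rightarrow> int) set" where
  "labellings X = measurable X (count_space {-1, 1}) \<inter> extensional (space X)"

definition disagreement :: "'x measure \<Rightarrow> ('x \<Rightarrow> int) \<Rightarrow> ('x \<Rightarrow> int) \<Rightarrow> real" where
  "disagreement D f g = measure D {x \<in> space D. f x \<noteq> g x}"

definition dist_class :: "'x measure \<Rightarrow> ('x \<Rightarrow> int) \<Rightarrow> ('x \<Rightarrow> int) set \<Rightarrow> real" where
  "dist_class D f H = (INF h\<in>H. disagreement D f h)"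

text \<open>
  A randomized algorithm is a family of deterministic algorithms indexed by a random seed, drawn
  from a Borel probability measure on the reals that the algorithm chooses; any standard Borel
  source of randomness, such as an infinite sequence of fair coin tosses, can be encoded in this
  way. No measurability is imposed on the family itself: \<open>measure\<close> is 0 on non-measurable sets,
  so each probability bound of the form \<open>2/3 \<le> measure \<dots>\<close> below already includes that the verdict
  in question is an event.
\<close>

definition random_seeds :: "real measure set" where
  "random_seeds = {R. prob_space R \<and> sets R = sets borel}"

definition iid_samples :: "nat \<Rightarrow> 'x measure \<Rightarrow> (nat \<Rightarrow> 'x) measure" where
  "iid_samples m D = Pi\<^sub>M {..<m} (\<lambda>_. D)"

type_synonym 'x sample_algorithm = "('x \<times> int) list \<Rightarrow> bool"

definition sample_verdict_prob ::
  "nat \<Rightarrow> real measure \<Rightarrow> (real \<Rightarrow> 'x sample_algorithm) \<Rightarrow> 'x measure \<Rightarrow> ('x \<Rightarrow> int) \<Rightarrow> bool \<Rightarrow> real"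
where
  "sample_verdict_prob m R A D f b =
     measure (R \<Otimes>\<^sub>M iid_samples m D)
       {\<omega> \<in> space (R \<Otimes>\<^sub>M iid_samples m D).
          A (fst \<omega>) (map (\<lambda>i. (snd \<omega> i, f (snd \<omega> i))) [0..<m]) = b}"

definition sample_tester ::
  "'x measure \<Rightarrow> ('x \<Rightarrow> int) set \<Rightarrow> real \<Rightarrow> nat \<Rightarrow> real measure \<Rightarrow> (real \<Rightarrow> 'x sample_algorithm) \<Rightarrow> bool"
where
  "sample_tester X H \<epsilon> m R A \<longleftrightarrow>
     R \<in> random_seeds \<and>
     (\<forall>D\<in>distributions X. \<forall>f\<in>labellings X.
        (f \<in> H \<longrightarrow> sample_verdict_prob m R A D f True \<ge> 2/3) \<and>
        (dist_class D f H \<ge> \<epsilon> \<longrightarrow> sample_verdict_prob m R A D f False \<ge> 2/3))"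

text \<open>The value is \<open>\<infinity>\<close> if no number of samples suffices.\<close>

definition m_test :: "'x measure \<Rightarrow> ('x \<Rightarrow> int) set \<Rightarrow> real \<Rightarrow> enat" where
  "m_test X H \<epsilon> = (INF m\<in>{m. \<exists>R A. sample_tester X H \<epsilon> m R A}. enat m)"

text \<open>
  A deterministic adaptive algorithm is a decision tree: it halts with a verdict, queries \<open>f\<close> at
  a point and continues depending on the answer, or draws a fresh sample and continues depending
  on the labelled example received.
\<close>

datatype 'x query_algorithm =
    Verdict bool
  | Query 'x "int \<Rightarrow> 'x query_algorithm"
  | Sample "'x \<times> int \<Rightarrow> 'x query_algorithm"

primrec at_most_ops :: "'x set \<Rightarrow> 'x query_algorithm \<Rightarrow> nat \<Rightarrow> bool" where
  "at_most_ops \<X> (Verdict b) q \<longleftrightarrow> True"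
| "at_most_ops \<X> (Query x k) q \<longleftrightarrow>
     0 < q \<and> x \<in> \<X> \<and> (\<forall>y\<in>{-1, 1}. at_most_ops \<X> (k y) (q - 1))"
| "at_most_ops \<X> (Sample k) q \<longleftrightarrow>
     0 < q \<and> (\<forall>z\<in>\<X> \<times> {-1, 1}. at_most_ops \<X> (k z) (q - 1))"

text \<open>The argument \<open>i\<close> counts the samples drawn so far; the next one drawn is \<open>s i\<close>.\<close>

primrec run :: "'x query_algorithm \<Rightarrow> ('x \<Rightarrow> int) \<Rightarrow> (nat \<Rightarrow> 'x) \<Rightarrow> nat \<Rightarrow> bool" where
  "run (Verdict b) f s i = b"
| "run (Query x k) f s i = run (k (f x)) f s i"
| "run (Sample k) f s i = run (k (s i, f (s i))) f s (Suc i)"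

definition query_verdict_prob ::
  "nat \<Rightarrow> real measure \<Rightarrow> (real \<Rightarrow> 'x query_algorithm) \<Rightarrow> 'x measure \<Rightarrow> ('x \<Rightarrow> int) \<Rightarrow> bool \<Rightarrow> real"
where
  "query_verdict_prob q R A D f b =
     measure (R \<Otimes>\<^sub>M iid_samples q D)
       {\<omega> \<in> space (R \<Otimes>\<^sub>M iid_samples q D). run (A (fst \<omega>)) f (snd \<omega>) 0 = b}"

definition query_tester ::
  "'x measure \<Rightarrow> ('x \<Rightarrow> int) set \<Rightarrow> real \<Rightarrow> nat \<Rightarrow> real measure \<Rightarrow> (real \<Rightarrow> 'x query_algorithm) \<Rightarrow> bool"
where
  "query_tester X H \<epsilon> q R A \<longleftrightarrow>
     R \<in> random_seeds \<and>
     (\<forall>r. at_most_ops (space X) (A r) q) \<and>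
     (\<forall>D\<in>distributions X. \<forall>f\<in>labellings X.
        (dist_class D f H = 0 \<longrightarrow> query_verdict_prob q R A D f True \<ge> 2/3) \<and>
        (dist_class D f H \<ge> \<epsilon> \<longrightarrow> query_verdict_prob q R A D f False \<ge> 2/3))"

definition q_test0 :: "'x measure \<Rightarrow> ('x \<Rightarrow> int) set \<Rightarrow> real \<Rightarrow> enat" where
  "q_test0 X H \<epsilon> = (INF q\<in>{q. \<exists>R A. query_tester X H \<epsilon> q R A}. enat q)"

text \<open>
  The dimension varies inside the theorem, so \<open>\<real>\<^sup>n\<close> is the set of extensional functions on
  \<open>{1..n}\<close>, with the product (that is, Borel) sigma-algebra.
\<close>

definition Rn :: "nat \<Rightarrow> (nat \<Rightarrow> real) measure" where
  "Rn n = Pi\<^sub>M {1..n} (\<lambda>_. borel)"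

text \<open>Unlike \<open>sgn\<close>, this takes the value 1 at 0.\<close>

definition sign_pm :: "real \<Rightarrow> int" where
  "sign_pm z = (if z \<ge> 0 then 1 else -1)"

definition halfspace :: "nat \<Rightarrow> (nat \<Rightarrow> real) \<Rightarrow> (nat \<Rightarrow> real) \<Rightarrow> int" where
  "halfspace n w = restrict (\<lambda>x. sign_pm (w 0 + (\<Sum>i=1..n. w i * x i))) (space (Rn n))"

definition halfspaces :: "nat \<Rightarrow> ((nat \<Rightarrow> real) \<Rightarrow> int) set" where
  "halfspaces n = range (halfspace n)"

end

theory Submission
  imports Defs
begin

text \<open>
  Label the points \<open>(i, i\<^sup>2, \<dots>, i\<^sup>n)\<close> of the moment curve alternately by \<open>\<plusminus>1\<close>. By interpolation, every
  distribution supported on at most \<open>n + 1\<close> of them is consistent with a halfspace, whereas a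
  halfspace changes sign at most \<open>n\<close> times along the curve and hence errs on \<open>2 n\<close> of the equally
  likely atoms when there are about \<open>8 n\<close> of them. The labels being fixed, neither labels nor queries
  reveal anything about the distribution, so a tester has to estimate the support size from \<open>m\<close>
  samples.

  Draw the mass of each of \<open>8 n\<close> sites independently, from one of two laws that agree in about
  \<open>log n\<close> moments: under the first law a mass is almost always zero, under the second it almost always
  equals its smallest nonzero value, of order \<open>1 / n\<close>. Such laws live on the shifted Chebyshev
  extrema \<open>a + 1 - cos (\<pi> j / M)\<close>: weights of alternating sign annihilate polynomials of low degree, and
  a squared Dirichlet kernel concentrates one of the signs on the smallest node. The largest node
  exceeds the smallest by a factor \<open>O(log\<^sup>2 n)\<close>.

  Stick breaking turns any vector of masses into a probability vector that is affine in each of its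
  coordinates, so the acceptance probability is a polynomial in each mass, whose \<open>k\<close>-th coefficient is
  at most \<open>2\<^sup>k\<close> times the binomial coefficient of \<open>m\<close> and \<open>k\<close>. Replacing one law by the other site by
  site therefore changes the mean acceptance probability by a small constant only, as long as
  \<open>m < n / log n\<close>.
\<close>

section \<open>Trigonometric sums\<close>

text \<open>Multiplication by \<open>2 * sin (\<alpha> / 2)\<close> makes the sum telescope, and the
  end values agree because the angle advances by \<open>h\<close> full periods. The bound on
  \<open>h\<close> keeps that sine from vanishing.\<close>

lemma sum_cos_multiples_eq_0:
  fixes h :: int and M :: nat
  assumes "h \<noteq> 0" and "\<bar>h\<bar> < 2 * int M"
  shows "(\<Sum>j<2 * M. cos (of_int h * (pi * real j / real M))) = 0"
proof -
  define \<alpha> where "\<alpha> = of_int h * pi / real M"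
  define f where "f j = sin ((real j - 1 / 2) * \<alpha>)" for j
  have M: "real M > 0" using assms by (cases M) auto
  have "sin (\<alpha> / 2) \<noteq> 0"
  proof
    assume "sin (\<alpha> / 2) = 0"
    then obtain i :: int where i: "\<alpha> / 2 = of_int i * pi"
      by (auto simp: sin_zero_iff_int2)
    then have "real_of_int h = 2 * of_int i * real M"
      using M by (simp add: \<alpha>_def field_simps)
    then have "real_of_int h = real_of_int (2 * i * int M)" by simp
    then have h: "h = 2 * i * int M" using of_int_eq_iff by blast
    with \<open>h \<noteq> 0\<close> have "\<bar>i\<bar> \<ge> 1" by auto
    then have "1 * int M \<le> \<bar>i\<bar> * int M" by (intro mult_right_mono) auto
    then have "\<bar>h\<bar> \<ge> 2 * int M" unfolding h by (simp add: abs_mult)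
    with assms show False by simp
  qed
  moreover have "2 * sin (\<alpha> / 2) * cos (of_int h * (pi * real j / real M)) = f (Suc j) - f j" for j
  proof -
    have e: "of_int h * (pi * real j / real M) = real j * \<alpha>" by (simp add: \<alpha>_def)
    have "f (Suc j) = sin (real j * \<alpha> + \<alpha> / 2)" "f j = sin (real j * \<alpha> - \<alpha> / 2)"
      by (simp_all add: f_def algebra_simps)
    then show ?thesis unfolding e by (simp add: sin_add sin_diff)
  qed
  then have "2 * sin (\<alpha> / 2) * (\<Sum>j<2 * M. cos (of_int h * (pi * real j / real M))) = f (2 * M) - f 0"
    by (simp add: sum_distrib_left sum_lessThan_telescope)
  moreover have "f (2 * M) = f 0"
  proof -
    have "(real (2 * M) - 1 / 2) * \<alpha> = - (\<alpha> / 2) + of_int h * (2 * pi)"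
      using M by (simp add: \<alpha>_def field_simps)
    then have "f (2 * M) = sin (- (\<alpha> / 2) + of_int h * (2 * pi))"
      by (simp only: f_def)
    also have "\<dots> = sin (- (\<alpha> / 2))"
      by (simp add: sin_diff mult.commute [of _ "2 * pi"])
    finally show ?thesis by (simp add: f_def)
  qed
  ultimately show ?thesis by simp
qed

text \<open>At the nodes the sign \<open>(- 1) ^ j\<close> is a cosine of frequency
  \<open>M\<close>, so it shifts the frequency \<open>k\<close> to \<open>k + M\<close>, strictly
  between 0 and \<open>2 * M\<close>. Each factor of the power moves the frequency by at most one,
  hence the induction on \<open>i\<close>.\<close>

lemma sum_alternating_cos_power_eq_0:
  fixes k :: int and M i :: nat and a :: real
  assumes "\<bar>k\<bar> + int i < int M"
  shows "(\<Sum>j<2 * M. (- 1) ^ j * cos (of_int k * (pi * real j / real M)) * (a + 1 - cos (pi * real j / real M)) ^ i) = 0"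
  using assms
proof (induction i arbitrary: k)
  case 0
  have M: "M > 0" using 0 by (cases M) auto
  have "(- 1) ^ j * cos (of_int k * (pi * real j / real M)) = cos (of_int (k + int M) * (pi * real j / real M))" for j
  proof -
    have "of_int (k + int M) * (pi * real j / real M) = of_int k * (pi * real j / real M) + real j * pi"
      using M by (simp add: field_simps)
    then show ?thesis by (simp add: cos_add cos_npi)
  qed
  then show ?case using 0 by (simp add: sum_cos_multiples_eq_0 del: of_int_add times_divide_eq_right)
next
  case (Suc i)
  define t where "t j = pi * real j / real M" for j
  define S where "S k = (\<Sum>j<2 * M. (- 1) ^ j * cos (of_int k * t j) * (a + 1 - cos (t j)) ^ i)" for k :: int
  have S: "S k' = 0" if "\<bar>k'\<bar> \<le> \<bar>k\<bar> + 1" for k'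
    unfolding S_def t_def by (rule Suc.IH) (use Suc.prems that in auto)
  have c: "cos (of_int k * t j) * (a + 1 - cos (t j)) =
     (a + 1) * cos (of_int k * t j) - (cos (of_int (k + 1) * t j) + cos (of_int (k - 1) * t j)) / 2" for j
    by (simp add: algebra_simps cos_add cos_diff)
  have "(- 1) ^ j * cos (of_int k * t j) * (a + 1 - cos (t j)) ^ Suc i =
      (a + 1) * ((- 1) ^ j * cos (of_int k * t j) * (a + 1 - cos (t j)) ^ i)
    - (1 / 2) * ((- 1) ^ j * cos (of_int (k + 1) * t j) * (a + 1 - cos (t j)) ^ i)
    - (1 / 2) * ((- 1) ^ j * cos (of_int (k - 1) * t j) * (a + 1 - cos (t j)) ^ i)" (is "?l = ?r") for j
  proof -
    have "?l = (- 1) ^ j * (cos (of_int k * t j) * (a + 1 - cos (t j))) * (a + 1 - cos (t j)) ^ i"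
      by (simp only: power_Suc mult_ac)
    also have "\<dots> = ?r" unfolding c
      by (simp only: algebra_simps add_divide_distrib) (simp add: algebra_simps)
    finally show ?thesis .
  qed
  then have "(\<Sum>j<2 * M. (- 1) ^ j * cos (of_int k * t j) * (a + 1 - cos (t j)) ^ Suc i)
      = (a + 1) * S k - (1 / 2) * S (k + 1) - (1 / 2) * S (k - 1)"
    unfolding S_def by (simp only: sum_subtractf sum_distrib_left)
  also have "\<dots> = 0" using S by simp
  finally show ?case by (simp add: t_def)
qed

section \<open>The squared Dirichlet kernel at equally spaced angles\<close>

definition dirichlet_kernel :: "nat \<Rightarrow> real \<Rightarrow> real" where
  "dirichlet_kernel d t = (\<Sum>k = - int d..int d. cos (of_int k * t))"

lemma dirichlet_kernel_0: "dirichlet_kernel d 0 = 2 * real d + 1"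
  by (simp add: dirichlet_kernel_def)

text \<open>The products of sines add up to zero because sine is odd and the range symmetric; adding
  them turns each product of cosines into a cosine of frequency at most
  \<open>2 * d\<close>.\<close>

lemma dirichlet_kernel_squared:
  "(dirichlet_kernel d t)\<^sup>2 = (\<Sum>k = - int d..int d. \<Sum>l = - int d..int d. cos (of_int (k - l) * t))"
proof -
  have s: "(\<Sum>l = - int d..int d. sin (of_int l * t)) = 0"
  proof -
    have "(\<Sum>l = - int d..int d. sin (of_int l * t)) = (\<Sum>l = - int d..int d. sin (of_int (- l) * t))"
      by (rule sum.reindex_bij_witness [of _ uminus uminus]) auto
    then show ?thesis by (simp add: sum_negf)
  qed
  have "(dirichlet_kernel d t)\<^sup>2 =
     (\<Sum>k = - int d..int d. \<Sum>l = - int d..int d. cos (of_int k * t) * cos (of_int l * t))"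
    by (simp add: dirichlet_kernel_def power2_eq_square sum_product)
  also have "\<dots> = (\<Sum>k = - int d..int d. \<Sum>l = - int d..int d.
      cos (of_int k * t) * cos (of_int l * t) + sin (of_int k * t) * sin (of_int l * t))"
    by (simp add: sum.distrib s flip: sum_distrib_left)
  also have "\<dots> = (\<Sum>k = - int d..int d. \<Sum>l = - int d..int d. cos (of_int (k - l) * t))"
    by (simp add: left_diff_distrib cos_diff)
  finally show ?thesis .
qed

text \<open>Discrete Parseval identity: all frequencies \<open>k - l\<close> are below
  \<open>2 * M\<close> in absolute value, so only the diagonal survives.\<close>

lemma sum_dirichlet_kernel_squared:
  assumes "d < M"
  shows "(\<Sum>j<2 * M. (dirichlet_kernel d (pi * real j / real M))\<^sup>2) = 2 * real M * (2 * real d + 1)"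
proof -
  have "(\<Sum>j<2 * M. (dirichlet_kernel d (pi * real j / real M))\<^sup>2) =
     (\<Sum>k = - int d..int d. \<Sum>l = - int d..int d. \<Sum>j<2 * M. cos (of_int (k - l) * (pi * real j / real M)))"
    unfolding dirichlet_kernel_squared
    by (subst sum.swap, rule sum.cong [OF refl], subst sum.swap, rule refl)
  also have "\<dots> = (\<Sum>k = - int d..int d. \<Sum>l = - int d..int d. if l = k then 2 * real M else 0)"
  proof (intro sum.cong refl)
    fix k l assume "k \<in> {- int d..int d}" "l \<in> {- int d..int d}"
    then have "\<bar>k - l\<bar> < 2 * int M" using assms by auto
    then show "(\<Sum>j<2 * M. cos (of_int (k - l) * (pi * real j / real M))) = (if l = k then 2 * real M else 0)"
      by (cases "l = k") (simp_all add: sum_cos_multiples_eq_0 del: of_int_diff times_divide_eq_right)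
  qed
  also have "\<dots> = 2 * real M * (2 * real d + 1)"
    by simp
  finally show ?thesis .
qed

text \<open>Of the degrees below \<open>M\<close> that alternating signs annihilate, the squared
  kernel uses up \<open>2 * d\<close>; the power may use the rest.\<close>

lemma sum_alternating_dirichlet_kernel_squared_eq_0:
  assumes "2 * d + i < M"
  shows "(\<Sum>j<2 * M. (- 1) ^ j * (dirichlet_kernel d (pi * real j / real M))\<^sup>2 * (a + 1 - cos (pi * real j / real M)) ^ i) = 0"
proof -
  have "(\<Sum>j<2 * M. (- 1) ^ j * (dirichlet_kernel d (pi * real j / real M))\<^sup>2 * (a + 1 - cos (pi * real j / real M)) ^ i)
    = (\<Sum>j<2 * M. \<Sum>k = - int d..int d. \<Sum>l = - int d..int d.
        (- 1) ^ j * cos (of_int (k - l) * (pi * real j / real M)) * (a + 1 - cos (pi * real j / real M)) ^ i)"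
    unfolding dirichlet_kernel_squared by (simp only: sum_distrib_left sum_distrib_right)
  also have "\<dots> = (\<Sum>k = - int d..int d. \<Sum>l = - int d..int d. \<Sum>j<2 * M.
        (- 1) ^ j * cos (of_int (k - l) * (pi * real j / real M)) * (a + 1 - cos (pi * real j / real M)) ^ i)"
    by (subst sum.swap, rule sum.cong [OF refl], subst sum.swap, rule refl)
  also have "\<dots> = 0"
    using assms by (intro sum.neutral ballI sum_alternating_cos_power_eq_0) auto
  finally show ?thesis .
qed

section \<open>Distances between the nodes\<close>

lemma abs_sin_multiple_le: "\<bar>sin (real n * x)\<bar> \<le> real n * \<bar>sin x\<bar>"
proof (induction n)
  case (Suc n)
  have "\<bar>sin (real (Suc n) * x)\<bar> = \<bar>sin (real n * x) * cos x + cos (real n * x) * sin x\<bar>"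
    by (simp add: distrib_right sin_add algebra_simps)
  also have "\<dots> \<le> \<bar>sin (real n * x)\<bar> * \<bar>cos x\<bar> + \<bar>cos (real n * x)\<bar> * \<bar>sin x\<bar>"
    by (metis abs_mult abs_triangle_ineq)
  also have "\<dots> \<le> \<bar>sin (real n * x)\<bar> + \<bar>sin x\<bar>"
    by (intro add_mono mult_left_le mult_left_le_one_le) auto
  finally show ?case using Suc by (simp add: algebra_simps)
qed simp

text \<open>The start is \<open>1 = sin (pi / 2)\<close>, which is at most \<open>M\<close> times
  the sine of \<open>pi / (2 * M)\<close>; the double-angle formula turns the square of that sine
  into the gap after node 0.\<close>

lemma one_minus_cos_ge:
  assumes "M > 0"
  shows "1 - cos (pi / real M) \<ge> 2 / (real M)\<^sup>2"
proof -
  have "1 \<le> real M * \<bar>sin (pi / real M / 2)\<bar>"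
    using abs_sin_multiple_le [of M "pi / real M / 2"] assms by simp
  then have "1\<^sup>2 \<le> (real M * \<bar>sin (pi / real M / 2)\<bar>)\<^sup>2"
    by (intro power_mono) auto
  then have "1 / (real M)\<^sup>2 \<le> (sin (pi / real M / 2))\<^sup>2"
    using assms by (simp add: power_mult_distrib field_simps)
  moreover have "cos (pi / real M) = 1 - 2 * (sin (pi / real M / 2))\<^sup>2"
    using cos_double_sin [of "pi / real M / 2"] by simp
  ultimately show ?thesis by simp
qed

text \<open>Separates all odd nodes from node 0. An angle beyond \<open>pi\<close> is reflected to
  its difference from \<open>2 * pi\<close>, which is still at least \<open>pi / M\<close> because
  \<open>j\<close> is at most \<open>2 * M - 1\<close>.\<close>

lemma cos_odd_multiple_le:
  assumes "odd j" and "j < 2 * M"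
  shows "cos (pi * real j / real M) \<le> cos (pi / real M)"
proof -
  have M: "M > 0" using assms by auto
  have j: "j \<ge> 1" using assms by (cases j) auto
  show ?thesis
  proof (cases "j \<le> M")
    case True
    then have "pi * real j / real M \<le> pi" using M by (simp add: field_simps)
    moreover have "pi / real M \<le> pi * real j / real M"
      using j M by (simp add: field_simps)
    ultimately show ?thesis using M by (intro cos_monotone_0_pi_le) auto
  next
    case False
    have "j \<le> 2 * M - 1" using assms by auto
    then have r: "real j \<le> 2 * real M - 1" using M by linarith
    have "cos (pi * real j / real M) = cos (2 * pi - pi * real j / real M)"
      by simp
    also have "\<dots> \<le> cos (pi / real M)"
    proof (rule cos_monotone_0_pi_le)
      show "2 * pi - pi * real j / real M \<le> pi"
        using False M by (simp add: field_simps)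
      have "pi * real j \<le> pi * (2 * real M - 1)" using r by (intro mult_left_mono) auto
      then show "pi / real M \<le> 2 * pi - pi * real j / real M"
        using M by (simp add: field_simps)
    qed (use M in auto)
    finally show ?thesis .
  qed
qed

section \<open>Laws with matching moments\<close>

text \<open>The law \<open>p\<close> lives on \<open>0\<close> and the odd nodes, the law \<open>q\<close> on \<open>0\<close> and the even nodes. Dividing the
  alternating weights by the nodes shifts the matched moments by one and leaves the zeroth moment to
  be balanced by the atom at \<open>0\<close>.\<close>

lemma moment_matching_laws:
  fixes L :: nat and y :: real
  assumes L: "L \<ge> 1" and y: "y > 0"
  obtains K :: nat and v p q :: "nat \<Rightarrow> real" where
    "\<forall>j\<le>K. 0 \<le> v j \<and> v j \<le> y * (1 + 100 * (101 * real L + 1)\<^sup>2)"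
    "\<forall>j\<le>K. 0 \<le> p j" "\<forall>j\<le>K. 0 \<le> q j" "(\<Sum>j\<le>K. p j) = 1" "(\<Sum>j\<le>K. q j) = 1"
    "\<forall>k\<le>L + 1. (\<Sum>j\<le>K. p j * v j ^ k) = (\<Sum>j\<le>K. q j * v j ^ k)"
    "(\<Sum>j\<le>K. p j * of_bool (v j \<noteq> 0)) \<le> 1 / 100"
    "(\<Sum>j\<le>K. q j * of_bool (v j \<noteq> y)) \<le> 1 / 101"
    "(\<Sum>j\<le>K. q j * v j) \<le> y"
proof -
  \<comment> \<open>Matching up to degree \<open>L\<close> needs \<open>2 * d + L < M\<close>; these
    values also leave the mass \<open>(2 * d + 1) / M\<close> at node 0 no smaller than 100 /
    101.\<close>
  define M d where "M = 101 * L + 1" and "d = 50 * L"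
  \<comment> \<open>A hundredth of the gap after node 0: every odd node is then at least 100 times
    the smallest node \<open>z 0 = a\<close>, so dividing by the nodes shrinks the odd weights to a
    total of at most 1 / 100.\<close>
  define a where "a = (1 - cos (pi / real M)) / 100"
  define z where "z j = a + 1 - cos (pi * real j / real M)" for j
  \<comment> \<open>Normalised to total mass 2, which splits into mass 1 for each parity.\<close>
  define \<nu> where "\<nu> j = (dirichlet_kernel d (pi * real j / real M))\<^sup>2 / (real M * (2 * real d + 1))" for j
  define w where "w j = \<nu> j * a / z j" for j
  \<comment> \<open>The extra index \<open>2 * M\<close> is the atom at 0 and takes up the mass that
    the weights \<open>w\<close> lack; the scaling puts node 0 at \<open>y\<close>.\<close>
  define v where "v j = (if j = 2 * M then 0 else y * z j / a)" for j
  define ev od :: "nat \<Rightarrow> real" where "ev j = of_bool (even j)" and "od j = of_bool (odd j)" for j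
  define law where "law c j = (if j = 2 * M then 1 - (\<Sum>j<2 * M. c j * w j) else c j * w j)" for c :: "nat \<Rightarrow> real" and j
  have M: "M > 0" and dM: "d < M" by (auto simp: M_def d_def)
  have a_ge: "a \<ge> 2 / (100 * (real M)\<^sup>2)" using one_minus_cos_ge [OF M] by (simp add: a_def)
  moreover have "2 / (100 * (real M)\<^sup>2) > 0" using M by simp
  ultimately have a: "a > 0" by linarith
  have a100: "100 * a = 1 - cos (pi / real M)" by (simp add: a_def)
  have z_ge: "z j \<ge> a" for j by (simp add: z_def)
  then have z: "z j > 0" for j using a by (meson less_le_trans)
  have z0: "z 0 = a" by (simp add: z_def)
  have \<nu>: "\<nu> j \<ge> 0" for j by (simp add: \<nu>_def)
  have w: "w j \<ge> 0" for j using \<nu> a z by (simp add: w_def less_imp_le)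
  have w_le: "w j \<le> \<nu> j" for j
  proof -
    have "\<nu> j * a \<le> \<nu> j * z j" using \<nu> z_ge by (intro mult_left_mono)
    then show ?thesis using z [of j] by (simp add: w_def field_simps)
  qed
  have sum_\<nu>: "(\<Sum>j<2 * M. \<nu> j) = 2"
  proof -
    have "(\<Sum>j<2 * M. \<nu> j) = 2 * real M * (2 * real d + 1) / (real M * (2 * real d + 1))"
      unfolding \<nu>_def sum_divide_distrib [symmetric] sum_dirichlet_kernel_squared [OF dM] ..
    also have "\<dots> = 2" using M by (simp add: divide_simps)
    finally show ?thesis .
  qed
  have match: "(\<Sum>j<2 * M. od j * \<nu> j * z j ^ i) = (\<Sum>j<2 * M. ev j * \<nu> j * z j ^ i)" if "i \<le> L" for i
  proof -
    have "ev j - od j = (- 1) ^ j" for j by (simp add: ev_def od_def)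
    then have "(\<Sum>j<2 * M. ev j * \<nu> j * z j ^ i) - (\<Sum>j<2 * M. od j * \<nu> j * z j ^ i)
      = (\<Sum>j<2 * M. (- 1) ^ j * \<nu> j * z j ^ i)"
      by (simp flip: sum_subtractf left_diff_distrib)
    also have "\<dots> = (\<Sum>j<2 * M. (- 1) ^ j * (dirichlet_kernel d (pi * real j / real M))\<^sup>2 *
        (a + 1 - cos (pi * real j / real M)) ^ i) / (real M * (2 * real d + 1))"
      by (simp add: \<nu>_def z_def sum_divide_distrib)
    also have "\<dots> = 0"
      using that by (subst sum_alternating_dirichlet_kernel_squared_eq_0) (simp_all add: M_def d_def)
    finally show ?thesis by simp
  qed
  have "(\<Sum>j<2 * M. od j * \<nu> j) + (\<Sum>j<2 * M. ev j * \<nu> j) = (\<Sum>j<2 * M. \<nu> j)"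
    unfolding sum.distrib [symmetric] by (rule sum.cong) (auto simp: ev_def od_def)
  then have half: "(\<Sum>j<2 * M. od j * \<nu> j) = 1" "(\<Sum>j<2 * M. ev j * \<nu> j) = 1"
    using match [of 0] sum_\<nu> by auto
  have sum_law: "(\<Sum>j\<le>2 * M. law c j * g j) =
      (\<Sum>j<2 * M. c j * w j * g j) + (1 - (\<Sum>j<2 * M. c j * w j)) * g (2 * M)" for c g
    by (simp add: lessThan_Suc_atMost [symmetric] law_def)
  have law_nonneg: "law c j \<ge> 0" if "\<And>j. c j \<ge> 0" "(\<Sum>j<2 * M. c j * \<nu> j) = 1" for c j
  proof -
    have "(\<Sum>j<2 * M. c j * w j) \<le> (\<Sum>j<2 * M. c j * \<nu> j)"
      using that w_le by (intro sum_mono mult_left_mono)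
    then show ?thesis using that w by (auto simp: law_def)
  qed
  \<comment> \<open>One factor \<open>v j\<close> cancels the division by \<open>z j\<close> in
    \<open>w\<close>, so moment \<open>Suc i\<close> of the law is a multiple of moment
    \<open>i\<close> of the undivided weights. The atom at 0 contributes nothing to positive
    moments.\<close>
  have moment: "(\<Sum>j\<le>2 * M. law c j * v j ^ Suc i) = y ^ Suc i / a ^ i * (\<Sum>j<2 * M. c j * \<nu> j * z j ^ i)" for c i
  proof -
    have "(\<Sum>j\<le>2 * M. law c j * v j ^ Suc i) = (\<Sum>j<2 * M. c j * w j * v j ^ Suc i)"
      unfolding sum_law by (simp add: v_def)
    also have "\<dots> = (\<Sum>j<2 * M. y ^ Suc i / a ^ i * (c j * \<nu> j * z j ^ i))"
    proof (rule sum.cong)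
      fix j assume "j \<in> {..<2 * M}"
      then have v: "v j = y * z j / a" by (simp add: v_def)
      show "c j * w j * v j ^ Suc i = y ^ Suc i / a ^ i * (c j * \<nu> j * z j ^ i)"
        unfolding v using a z [of j] by (simp add: w_def power_mult_distrib power_divide field_simps)
    qed simp
    finally show ?thesis by (simp add: sum_distrib_left)
  qed
  have c: "ev j \<ge> 0" "od j \<ge> 0" for j by (auto simp: ev_def od_def)
  have v_bounds: "0 \<le> v j \<and> v j \<le> y * (1 + 100 * (101 * real L + 1)\<^sup>2)" for j
  proof
    show "0 \<le> v j" using y a z [of j] by (simp add: v_def)
    show "v j \<le> y * (1 + 100 * (101 * real L + 1)\<^sup>2)"
    proof (cases "j = 2 * M")
      case False
      have "2 \<le> a * (100 * (real M)\<^sup>2)"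
        using a_ge M by (simp add: field_simps)
      moreover have "z j \<le> a + 2" using cos_ge_minus_one [of "pi * real j / real M"] by (simp add: z_def)
      ultimately have "z j \<le> a * (1 + 100 * (real M)\<^sup>2)" by (simp add: algebra_simps)
      then have "z j / a \<le> 1 + 100 * (real M)\<^sup>2" using a by (simp add: field_simps)
      then have "y * (z j / a) \<le> y * (1 + 100 * (real M)\<^sup>2)" using y by (intro mult_left_mono) auto
      moreover have "real M = 101 * real L + 1" by (simp add: M_def)
      ultimately show ?thesis using False by (simp add: v_def)
    qed (use y in \<open>simp add: v_def\<close>)
  qed
  show ?thesis
  proof (rule that [of "2 * M" v "law od" "law ev"])
    show "\<forall>j\<le>2 * M. 0 \<le> v j \<and> v j \<le> y * (1 + 100 * (101 * real L + 1)\<^sup>2)" using v_bounds by blast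
    show "\<forall>j\<le>2 * M. 0 \<le> law od j" "\<forall>j\<le>2 * M. 0 \<le> law ev j" using c half by (auto intro: law_nonneg)
    show one: "(\<Sum>j\<le>2 * M. law od j) = 1" "(\<Sum>j\<le>2 * M. law ev j) = 1"
      using sum_law [of _ "\<lambda>_. 1"] by simp_all
    have "(\<Sum>j\<le>2 * M. law od j * v j ^ k) = (\<Sum>j\<le>2 * M. law ev j * v j ^ k)" if "k \<le> L + 1" for k
    proof (cases k)
      case 0
      then show ?thesis using one by simp
    next
      case (Suc i)
      then show ?thesis using match [of i] that by (simp only: moment)
    qed
    then show "\<forall>k\<le>L + 1. (\<Sum>j\<le>2 * M. law od j * v j ^ k) = (\<Sum>j\<le>2 * M. law ev j * v j ^ k)"
      by blast
    show "(\<Sum>j\<le>2 * M. law ev j * v j) \<le> y"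
      using moment [of ev 0] half by simp
    have "(\<Sum>j\<le>2 * M. law od j * of_bool (v j \<noteq> 0)) \<le> (\<Sum>j<2 * M. od j * \<nu> j / 100)"
    proof -
      have "od j * w j * of_bool (v j \<noteq> 0) \<le> od j * \<nu> j / 100" if "j < 2 * M" for j
      proof (cases "odd j")
        case True
        have "z j \<ge> 100 * a"
          using cos_odd_multiple_le [OF True that] a a100 by (simp add: z_def)
        then have "\<nu> j * (100 * a) \<le> \<nu> j * z j" using \<nu> by (intro mult_left_mono)
        then have "w j \<le> \<nu> j / 100" using z [of j] by (simp add: w_def field_simps)
        then show ?thesis using \<nu> [of j] by (simp add: od_def)
      qed (simp add: od_def)
      then have "(\<Sum>j<2 * M. od j * w j * of_bool (v j \<noteq> 0)) \<le> (\<Sum>j<2 * M. od j * \<nu> j / 100)"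
        by (intro sum_mono) simp
      moreover have "v (2 * M) = 0" by (simp add: v_def)
      ultimately show ?thesis unfolding sum_law by simp
    qed
    then show "(\<Sum>j\<le>2 * M. law od j * of_bool (v j \<noteq> 0)) \<le> 1 / 100"
      using half by (simp flip: sum_divide_distrib)
    \<comment> \<open>Node 0 alone provides enough mass at \<open>y\<close>: there
      \<open>w 0 = \<nu> 0\<close>, the peak of the squared kernel.\<close>
    have "law ev 0 * 1 \<le> (\<Sum>j\<le>2 * M. law ev j * (1 - of_bool (v j \<noteq> y)))"
    proof -
      have "law ev 0 * 1 = law ev 0 * (1 - of_bool (v 0 \<noteq> y))"
        using a M by (simp add: v_def z0)
      also have "\<dots> \<le> (\<Sum>j\<le>2 * M. law ev j * (1 - of_bool (v j \<noteq> y)))"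
        using law_nonneg [of ev, OF c(1) half(2)]
        by (intro member_le_sum) auto
      finally show ?thesis .
    qed
    moreover have "law ev 0 = (2 * real d + 1) / real M"
      using M a by (simp add: law_def ev_def w_def z0 \<nu>_def dirichlet_kernel_0 power2_eq_square divide_simps)
    moreover have "(2 * real d + 1) / real M \<ge> 100 / 101"
      using M by (simp add: field_simps) (simp add: M_def d_def)
    moreover have "(\<Sum>j\<le>2 * M. law ev j * (1 - of_bool (v j \<noteq> y))) =
        1 - (\<Sum>j\<le>2 * M. law ev j * of_bool (v j \<noteq> y))"
      by (simp only: right_diff_distrib sum_subtractf mult_1_right one)
    ultimately show "(\<Sum>j\<le>2 * M. law ev j * of_bool (v j \<noteq> y)) \<le> 1 / 101"
      by linarith
  qed
qed

section \<open>Polynomials of low degree cannot tell the laws apart\<close>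

definition sequences :: "nat \<Rightarrow> 'a set \<Rightarrow> 'a list set" where
  "sequences m S = {l. set l \<subseteq> S \<and> length l = m}"

lemma finite_sequences: "finite S \<Longrightarrow> finite (sequences m S)"
  by (simp add: sequences_def finite_lists_length_eq)

lemma sum_sequences_Suc:
  "(\<Sum>l\<in>sequences (Suc m) S. f l) = (\<Sum>x\<in>S. \<Sum>l\<in>sequences m S. f (x # l))"
proof -
  have "sequences (Suc m) S = (\<lambda>(x, l). x # l) ` (S \<times> sequences m S)"
    by (auto simp: sequences_def length_Suc_conv image_iff)
  then have "(\<Sum>l\<in>sequences (Suc m) S. f l) = (\<Sum>(x, l)\<in>S \<times> sequences m S. f (x # l))"
    by (simp add: sum.reindex inj_on_def split_def)
  then show ?thesis by (simp add: sum.cartesian_product)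
qed

text \<open>A finite sum rather than an integral, so that it also makes sense for signed weights and
  is visibly polynomial in them.\<close>

definition iid_mean :: "nat \<Rightarrow> 'a set \<Rightarrow> ('a \<Rightarrow> real) \<Rightarrow> ('a list \<Rightarrow> real) \<Rightarrow> real" where
  "iid_mean m S D g = (\<Sum>l\<in>sequences m S. (\<Prod>x\<leftarrow>l. D x) * g l)"

lemma iid_mean_0: "iid_mean 0 S D g = g []"
proof -
  have "sequences 0 S = {[]}" by (auto simp: sequences_def)
  then show ?thesis by (simp add: iid_mean_def)
qed

lemma iid_mean_Suc: "iid_mean (Suc m) S D g = (\<Sum>x\<in>S. D x * iid_mean m S D (\<lambda>l. g (x # l)))"
  by (simp add: iid_mean_def sum_sequences_Suc sum_distrib_left mult_ac)

text \<open>The coefficient of \<open>y ^ k\<close> collects the ways to take \<open>\<beta>\<close>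
  in \<open>k\<close> of the \<open>m\<close> draws and \<open>\<alpha>\<close> in the others, each
  choice of draws costing at most \<open>B ^ k\<close>. In the induction this count is Pascal's
  rule.\<close>

lemma iid_mean_affine_poly:
  fixes \<alpha> \<beta> :: "'a \<Rightarrow> real" and g :: "'a list \<Rightarrow> real"
  assumes "finite S" and \<alpha>: "(\<Sum>x\<in>S. \<bar>\<alpha> x\<bar>) \<le> 1" and \<beta>: "(\<Sum>x\<in>S. \<bar>\<beta> x\<bar>) \<le> B"
    and "\<And>l. \<bar>g l\<bar> \<le> 1"
  shows "\<exists>P. (\<forall>y. poly P y = iid_mean m S (\<lambda>x. \<alpha> x + y * \<beta> x) g) \<and>
             (\<forall>k. \<bar>coeff P k\<bar> \<le> real (m choose k) * B ^ k)"
  using assms(4)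
proof (induction m arbitrary: g)
  case 0
  have "\<bar>coeff [:g []:] k\<bar> \<le> real (0 choose k) * B ^ k" for k
    using 0 by (cases k) auto
  moreover have "\<forall>y. poly [:g []:] y = iid_mean 0 S (\<lambda>x. \<alpha> x + y * \<beta> x) g"
    by (simp add: iid_mean_0)
  ultimately show ?case by blast
next
  case (Suc m)
  have "0 \<le> (\<Sum>x\<in>S. \<bar>\<beta> x\<bar>)" by (rule sum_nonneg) simp
  then have B: "B \<ge> 0" using \<beta> by linarith
  have "\<exists>P. (\<forall>y. poly P y = iid_mean m S (\<lambda>x. \<alpha> x + y * \<beta> x) (\<lambda>l. g (x # l))) \<and>
             (\<forall>k. \<bar>coeff P k\<bar> \<le> real (m choose k) * B ^ k)" for x
    by (rule Suc.IH) (rule Suc.prems)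
  then obtain P where P: "\<And>x y. poly (P x) y = iid_mean m S (\<lambda>x. \<alpha> x + y * \<beta> x) (\<lambda>l. g (x # l))"
    and coeff_P: "\<And>x k. \<bar>coeff (P x) k\<bar> \<le> real (m choose k) * B ^ k"
    by metis
  define Q where "Q = (\<Sum>x\<in>S. smult (\<alpha> x) (P x) + pCons 0 (smult (\<beta> x) (P x)))"
  have "poly Q y = iid_mean (Suc m) S (\<lambda>x. \<alpha> x + y * \<beta> x) g" for y
    by (simp add: Q_def poly_sum iid_mean_Suc P algebra_simps)
  moreover have "\<bar>coeff Q k\<bar> \<le> real (Suc m choose k) * B ^ k" for k
  proof -
    \<comment> \<open>Bounds the coefficient that multiplication by \<open>y\<close> shifts into
      position \<open>k\<close>; nothing arrives at position 0.\<close>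
    define c where "c = (case k of 0 \<Rightarrow> 0 | Suc i \<Rightarrow> real (m choose i) * B ^ i)"
    have "c \<ge> 0" using B by (simp add: c_def split: nat.split)
    have "\<bar>coeff Q k\<bar> \<le> (\<Sum>x\<in>S. \<bar>\<alpha> x\<bar> * (real (m choose k) * B ^ k) + \<bar>\<beta> x\<bar> * c)"
      unfolding Q_def coeff_sum
    proof (rule order_trans [OF sum_abs], rule sum_mono)
      fix x
      have "\<bar>coeff (pCons 0 (smult (\<beta> x) (P x))) k\<bar> \<le> \<bar>\<beta> x\<bar> * c"
        using coeff_P by (auto simp: c_def coeff_pCons abs_mult split: nat.split intro!: mult_left_mono)
      moreover have "\<bar>coeff (smult (\<alpha> x) (P x)) k\<bar> \<le> \<bar>\<alpha> x\<bar> * (real (m choose k) * B ^ k)"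
        using coeff_P by (auto simp: abs_mult intro!: mult_left_mono)
      ultimately show "\<bar>coeff (smult (\<alpha> x) (P x) + pCons 0 (smult (\<beta> x) (P x))) k\<bar>
          \<le> \<bar>\<alpha> x\<bar> * (real (m choose k) * B ^ k) + \<bar>\<beta> x\<bar> * c"
        unfolding coeff_add by linarith
    qed
    also have "\<dots> = (\<Sum>x\<in>S. \<bar>\<alpha> x\<bar>) * (real (m choose k) * B ^ k) + (\<Sum>x\<in>S. \<bar>\<beta> x\<bar>) * c"
      by (simp add: sum.distrib sum_distrib_right)
    also have "\<dots> \<le> 1 * (real (m choose k) * B ^ k) + B * c"
      using \<alpha> \<beta> B \<open>c \<ge> 0\<close> by (intro add_mono mult_right_mono) auto
    also have "\<dots> = real (Suc m choose k) * B ^ k"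
      by (cases k) (simp_all add: c_def algebra_simps)
    finally show ?thesis .
  qed
  ultimately show ?case by blast
qed

text \<open>The tail of the binomial sum is estimated by the exponential moment trick
  \<open>1 \<le> exp (k - (L + 1))\<close> for \<open>k > L\<close>.\<close>

lemma moment_matching_poly_diff_le:
  fixes P :: "real poly" and p q v :: "'j \<Rightarrow> real"
  assumes J: "finite J" and v: "\<And>j. j \<in> J \<Longrightarrow> 0 \<le> v j \<and> v j \<le> b"
    and p: "\<And>j. j \<in> J \<Longrightarrow> 0 \<le> p j" "sum p J = 1" and q: "\<And>j. j \<in> J \<Longrightarrow> 0 \<le> q j" "sum q J = 1"
    and match: "\<And>k. k \<le> L \<Longrightarrow> (\<Sum>j\<in>J. p j * v j ^ k) = (\<Sum>j\<in>J. q j * v j ^ k)"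
    and P: "\<And>k. \<bar>coeff P k\<bar> \<le> real (m choose k) * B ^ k" and B: "B \<ge> 0"
  shows "\<bar>(\<Sum>j\<in>J. p j * poly P (v j)) - (\<Sum>j\<in>J. q j * poly P (v j))\<bar>
           \<le> exp (exp 1 * B * b * real m - (real L + 1))"
proof -
  have "J \<noteq> {}" using p by auto
  then have b: "b \<ge> 0" using v by force
  have "coeff P k = 0" if "k > m" for k
    using P [of k] that by (simp add: binomial_eq_0)
  then have "degree P \<le> m" by (intro degree_le) auto
  then have poly_P: "poly P y = (\<Sum>k\<le>m. coeff P k * y ^ k)" for y
    unfolding poly_altdef by (intro sum.mono_neutral_left) (auto simp: coeff_eq_0)
  define \<delta> where "\<delta> k = (\<Sum>j\<in>J. p j * v j ^ k) - (\<Sum>j\<in>J. q j * v j ^ k)" for k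
  have mean: "0 \<le> (\<Sum>j\<in>J. r j * v j ^ k)" "(\<Sum>j\<in>J. r j * v j ^ k) \<le> b ^ k"
    if r: "\<And>j. j \<in> J \<Longrightarrow> 0 \<le> r j" "sum r J = 1" for r k
  proof -
    show "0 \<le> (\<Sum>j\<in>J. r j * v j ^ k)" using r v by (intro sum_nonneg) auto
    have "(\<Sum>j\<in>J. r j * v j ^ k) \<le> (\<Sum>j\<in>J. r j * b ^ k)"
      using r v by (intro sum_mono mult_left_mono power_mono) auto
    then show "(\<Sum>j\<in>J. r j * v j ^ k) \<le> b ^ k" using r by (simp flip: sum_distrib_right)
  qed
  have \<delta>: "\<bar>\<delta> k\<bar> \<le> exp (real k - (real L + 1)) * b ^ k" for k
  proof (cases "k \<le> L")
    case True
    then show ?thesis using match b by (simp add: \<delta>_def)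
  next
    case False
    have "\<bar>\<delta> k\<bar> \<le> 1 * b ^ k"
      using mean [OF p, of k] mean [OF q, of k] by (simp add: \<delta>_def)
    also have "\<dots> \<le> exp (real k - (real L + 1)) * b ^ k"
      using False b by (intro mult_right_mono) auto
    finally show ?thesis .
  qed
  have "(\<Sum>j\<in>J. r j * poly P (v j)) = (\<Sum>k\<le>m. coeff P k * (\<Sum>j\<in>J. r j * v j ^ k))" for r
    unfolding poly_P sum_distrib_left by (subst sum.swap) (simp add: mult_ac)
  then have "\<bar>(\<Sum>j\<in>J. p j * poly P (v j)) - (\<Sum>j\<in>J. q j * poly P (v j))\<bar> = \<bar>\<Sum>k\<le>m. coeff P k * \<delta> k\<bar>"
    by (simp add: \<delta>_def sum_subtractf right_diff_distrib)
  also have "\<dots> \<le> (\<Sum>k\<le>m. (real (m choose k) * B ^ k) * (exp (real k - (real L + 1)) * b ^ k))"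
    using P \<delta> B by (intro order_trans [OF sum_abs] sum_mono) (auto simp: abs_mult intro!: mult_mono)
  also have "\<dots> = exp (- (real L + 1)) * (\<Sum>k\<le>m. real (m choose k) * (exp 1 * B * b) ^ k * 1 ^ (m - k))"
  proof -
    have "exp (real k - (real L + 1)) = exp (- (real L + 1)) * exp 1 ^ k" for k
      by (simp add: exp_diff exp_add exp_minus exp_of_nat_mult [symmetric] field_simps)
    then show ?thesis by (simp add: sum_distrib_left power_mult_distrib mult_ac)
  qed
  also have "\<dots> = exp (- (real L + 1)) * (exp 1 * B * b + 1) ^ m"
    by (simp add: binomial_ring)
  also have "\<dots> \<le> exp (- (real L + 1)) * exp (exp 1 * B * b) ^ m"
    using B b exp_ge_add_one_self [of "exp 1 * B * b"] by (intro mult_left_mono power_mono) (auto simp: add.commute)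
  also have "\<dots> = exp (exp 1 * B * b * real m - (real L + 1))"
    by (simp add: exp_of_nat_mult [symmetric] exp_add [symmetric] algebra_simps)
  finally show ?thesis .
qed

section \<open>Expectations over independent sites\<close>

text \<open>A finite product expectation as a recursion that integrates out the last coordinate, so
  that laws can be exchanged site by site; coordinates from \<open>n\<close> on stay 0.\<close>

primrec expect :: "nat \<Rightarrow> (nat \<Rightarrow> real) \<Rightarrow> (nat \<Rightarrow> real) \<Rightarrow> nat \<Rightarrow> ((nat \<Rightarrow> real) \<Rightarrow> real) \<Rightarrow> real" where
  "expect K v p 0 \<Phi> = \<Phi> (\<lambda>_. 0)"
| "expect K v p (Suc n) \<Phi> = expect K v p n (\<lambda>x. \<Sum>j\<le>K. p j * \<Phi> (x(n := v j)))"

definition unit_vectors :: "(nat \<Rightarrow> real) set" where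
  "unit_vectors = {x. \<forall>i. 0 \<le> x i \<and> x i \<le> 1}"

lemma unit_vectors_update: "x \<in> unit_vectors \<Longrightarrow> 0 \<le> y \<Longrightarrow> y \<le> 1 \<Longrightarrow> x(i := y) \<in> unit_vectors"
  by (simp add: unit_vectors_def)

locale finite_law =
  fixes K :: nat and v p :: "nat \<Rightarrow> real"
  assumes v: "\<And>j. j \<le> K \<Longrightarrow> 0 \<le> v j \<and> v j \<le> 1"
    and nonneg: "\<And>j. j \<le> K \<Longrightarrow> 0 \<le> p j" and sum_1: "(\<Sum>j\<le>K. p j) = 1"
begin

lemma expect_mono:
  "(\<And>x. x \<in> unit_vectors \<Longrightarrow> \<Phi> x \<le> \<Psi> x) \<Longrightarrow> expect K v p n \<Phi> \<le> expect K v p n \<Psi>"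
proof (induction n arbitrary: \<Phi> \<Psi>)
  case 0
  then show ?case by (simp add: unit_vectors_def)
next
  case (Suc n)
  show ?case unfolding expect.simps
    by (intro Suc.IH sum_mono mult_left_mono Suc.prems unit_vectors_update) (use v nonneg in auto)
qed

text \<open>Linearity of expectation in the form that later replaces Markov's inequality: acceptance
  is compared pointwise with such affine sums.\<close>

lemma expect_affine_sum:
  "expect K v p n (\<lambda>x. c + (\<Sum>i<n. g (x i))) = c + real n * (\<Sum>j\<le>K. p j * g (v j))"
proof (induction n arbitrary: c)
  case (Suc n)
  have e: "(\<Sum>j\<le>K. p j * (c + (\<Sum>i<Suc n. g ((x(n := v j)) i)))) =
      (c + (\<Sum>j\<le>K. p j * g (v j))) + (\<Sum>i<n. g (x i))" for x
  proof -
    have "(\<Sum>i<Suc n. g ((x(n := v j)) i)) = (\<Sum>i<n. g (x i)) + g (v j)" for j by simp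
    then show ?thesis
      by (simp only: distrib_left sum.distrib sum_1 mult_1 add.assoc add.left_commute flip: sum_distrib_right)
  qed
  show ?case unfolding expect.simps e Suc.IH by (simp add: algebra_simps)
qed simp

lemma expect_add_const: "expect K v p n (\<lambda>x. \<Phi> x + c) = expect K v p n \<Phi> + c"
proof (induction n arbitrary: \<Phi>)
  case (Suc n)
  have e: "(\<Sum>j\<le>K. p j * (\<Phi> (x(n := v j)) + c)) = (\<Sum>j\<le>K. p j * \<Phi> (x(n := v j))) + c" for x
    by (simp add: distrib_left sum.distrib sum_1 flip: sum_distrib_right)
  show ?case unfolding expect.simps e by (rule Suc.IH)
qed simp

lemma expect_diff_le:
  assumes "\<And>x. x \<in> unit_vectors \<Longrightarrow> \<bar>\<Phi> x - \<Psi> x\<bar> \<le> c"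
  shows "\<bar>expect K v p n \<Phi> - expect K v p n \<Psi>\<bar> \<le> c"
proof -
  have "expect K v p n \<Phi> \<le> expect K v p n (\<lambda>x. \<Psi> x + c)"
    using assms by (intro expect_mono) (auto simp: abs_le_iff algebra_simps)
  moreover have "expect K v p n \<Psi> \<le> expect K v p n (\<lambda>x. \<Phi> x + c)"
    using assms by (intro expect_mono) (auto simp: abs_le_iff algebra_simps)
  ultimately show ?thesis by (simp add: expect_add_const)
qed

end

text \<open>Hybrid argument: with the last site integrated out under \<open>p\<close>, induction
  exchanges the law at the other sites, and then the last site is exchanged under \<open>q\<close>.
  Every exchange costs at most \<open>\<delta>\<close>.\<close>

lemma expect_swap_law:
  assumes "finite_law K v p" and "finite_law K v q"
    and "\<And>x i. x \<in> unit_vectors \<Longrightarrow> i < n \<Longrightarrow>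
      \<bar>(\<Sum>j\<le>K. p j * \<Phi> (x(i := v j))) - (\<Sum>j\<le>K. q j * \<Phi> (x(i := v j)))\<bar> \<le> \<delta>"
  shows "\<bar>expect K v p n \<Phi> - expect K v q n \<Phi>\<bar> \<le> real n * \<delta>"
  using assms(3)
proof (induction n arbitrary: \<Phi>)
  case (Suc n)
  interpret p: finite_law K v p by fact
  interpret q: finite_law K v q by fact
  define \<Psi> where "\<Psi> r x = (\<Sum>j\<le>K. r j * \<Phi> (x(n := v j)))" for r x
  have "\<bar>expect K v p n (\<Psi> p) - expect K v q n (\<Psi> p)\<bar> \<le> real n * \<delta>"
  proof (rule Suc.IH)
    fix x :: "nat \<Rightarrow> real" and i assume x: "x \<in> unit_vectors" and i: "i < n"
    define d where "d l = (\<Sum>j\<le>K. p j * \<Phi> (x(n := v l, i := v j))) - (\<Sum>j\<le>K. q j * \<Phi> (x(n := v l, i := v j)))" for l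
    have d: "\<bar>d l\<bar> \<le> \<delta>" if "l \<le> K" for l
      unfolding d_def using x i that p.v by (intro Suc.prems unit_vectors_update) auto
    have "(\<Sum>j\<le>K. r j * \<Psi> p (x(i := v j))) = (\<Sum>l\<le>K. p l * (\<Sum>j\<le>K. r j * \<Phi> (x(n := v l, i := v j))))" for r
      unfolding \<Psi>_def sum_distrib_left using i
      by (subst sum.swap) (simp add: fun_upd_twist mult_ac)
    then have "\<bar>(\<Sum>j\<le>K. p j * \<Psi> p (x(i := v j))) - (\<Sum>j\<le>K. q j * \<Psi> p (x(i := v j)))\<bar> = \<bar>\<Sum>l\<le>K. p l * d l\<bar>"
      by (simp add: d_def sum_subtractf right_diff_distrib)
    also have "\<dots> \<le> (\<Sum>l\<le>K. p l * \<delta>)"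
      using d p.nonneg by (intro order_trans [OF sum_abs] sum_mono) (auto simp: abs_mult intro!: mult_left_mono)
    also have "\<dots> = \<delta>" by (simp add: p.sum_1 flip: sum_distrib_right)
    finally show "\<bar>(\<Sum>j\<le>K. p j * \<Psi> p (x(i := v j))) - (\<Sum>j\<le>K. q j * \<Psi> p (x(i := v j)))\<bar> \<le> \<delta>" .
  qed
  moreover have "\<bar>expect K v q n (\<Psi> p) - expect K v q n (\<Psi> q)\<bar> \<le> \<delta>"
    unfolding \<Psi>_def by (intro q.expect_diff_le Suc.prems) auto
  moreover have "\<Psi> r = (\<lambda>x. \<Sum>j\<le>K. r j * \<Phi> (x(n := v j)))" for r
    by (simp add: fun_eq_iff \<Psi>_def)
  ultimately show ?case
    by (simp add: algebra_simps)
qed simp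

section \<open>Stick breaking and support size\<close>

text \<open>Breaking a unit stick gives a probability vector for every \<open>x\<close>, whose dependence on each
  coordinate of \<open>x\<close> is affine; the site \<open>V\<close> receives the rest of the stick.\<close>

definition stick :: "nat \<Rightarrow> (nat \<Rightarrow> real) \<Rightarrow> nat \<Rightarrow> real" where
  "stick V x i = (if i < V then x i else 1) * (\<Prod>l<i. 1 - x l)"

lemma stick_nonneg: "x \<in> unit_vectors \<Longrightarrow> 0 \<le> stick V x i"
  by (auto simp: stick_def unit_vectors_def intro!: mult_nonneg_nonneg prod_nonneg)

lemma sum_stick: "(\<Sum>i\<le>V. stick V x i) = 1"
proof -
  have "(\<Sum>i<n. x i * (\<Prod>l<i. 1 - x l)) + (\<Prod>l<n. 1 - x l) = 1" for n
    by (induction n) (auto simp: algebra_simps)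
  then show ?thesis by (simp add: stick_def lessThan_Suc_atMost [symmetric])
qed

text \<open>Coordinate \<open>i\<close> enters piece \<open>s\<close> at most once: as the factor
  \<open>1 - x i\<close> if \<open>i < s\<close>, as \<open>x i\<close> if \<open>i = s\<close>, and
  not at all if \<open>i > s\<close>.\<close>

lemma stick_update:
  assumes "i < V"
  shows "stick V (x(i := y)) s =
    stick V (x(i := 0)) s + y * (stick V (x(i := 1)) s - stick V (x(i := 0)) s)"
proof (cases "i < s")
  case True
  have "(\<Prod>l<s. 1 - (x(i := c)) l) = (1 - c) * (\<Prod>l\<in>{..<s} - {i}. 1 - x l)" for c
    using True by (subst prod.remove [of _ i]) (auto intro!: prod.cong)
  then show ?thesis unfolding stick_def using True by (simp del: fun_upd_apply) (simp add: algebra_simps)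
next
  case False
  then have "(\<Prod>l<s. 1 - (x(i := c)) l) = (\<Prod>l<s. 1 - x l)" for c
    by (intro prod.cong) auto
  then show ?thesis unfolding stick_def using assms by (simp add: algebra_simps del: fun_upd_apply) (simp add: algebra_simps)
qed

text \<open>By the Weierstrass product inequality, the unbroken part of the stick never falls below
  one minus the sum of the \<open>x l\<close>, hence not below 1 / 2.\<close>

lemma stick_ge:
  assumes "x \<in> unit_vectors" and "(\<Sum>i<V. x i) \<le> 1 / 2" and "i < V"
  shows "stick V x i \<ge> x i / 2"
proof -
  have x: "0 \<le> x l" "x l \<le> 1" for l using assms by (auto simp: unit_vectors_def)
  have "1 - (\<Sum>l<n. x l) \<le> (\<Prod>l<n. 1 - x l)" for n
  proof (induction n)
    case (Suc n)
    have "(\<Prod>l<n. 1 - x l) \<le> 1" using x by (intro prod_le_1) auto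
    then have "x n * (\<Prod>l<n. 1 - x l) \<le> x n * 1" using x by (intro mult_left_mono)
    with Suc show ?case by (simp add: algebra_simps)
  qed simp
  then have "1 - (\<Sum>l<i. x l) \<le> (\<Prod>l<i. 1 - x l)" .
  moreover have "(\<Sum>l<i. x l) \<le> (\<Sum>l<V. x l)" using x assms(3) by (intro sum_mono2) auto
  ultimately have "1 / 2 \<le> (\<Prod>l<i. 1 - x l)" using assms(2) by linarith
  then have "x i * (1 / 2) \<le> x i * (\<Prod>l<i. 1 - x l)" using x by (intro mult_left_mono)
  then show ?thesis using assms(3) by (simp add: stick_def)
qed

section \<open>Exchanging the laws in the stick-breaking model\<close>

lemma iid_mean_bounds:
  assumes "finite S" and D: "\<And>x. x \<in> S \<Longrightarrow> 0 \<le> D x" "sum D S = 1"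
    and "\<And>l. 0 \<le> g l \<and> g l \<le> 1"
  shows "0 \<le> iid_mean m S D g \<and> iid_mean m S D g \<le> 1"
  using assms(4)
proof (induction m arbitrary: g)
  case (Suc m)
  have "(\<Sum>x\<in>S. D x * iid_mean m S D (\<lambda>l. g (x # l))) \<le> (\<Sum>x\<in>S. D x * 1)"
    using Suc D by (intro sum_mono mult_left_mono) auto
  moreover have "0 \<le> (\<Sum>x\<in>S. D x * iid_mean m S D (\<lambda>l. g (x # l)))"
    using Suc D by (intro sum_nonneg mult_nonneg_nonneg) auto
  ultimately show ?case using D by (simp add: iid_mean_Suc)
qed (simp add: iid_mean_0)

text \<open>In each coordinate the stick is \<open>\<alpha> + y * \<beta>\<close>, with
  \<open>\<alpha>\<close> a probability vector and \<open>\<beta>\<close> a difference of two. The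
  norm of \<open>\<beta>\<close> is thus at most 2, which is the factor 2 in the exponent, and the
  hybrid argument contributes the factor \<open>V\<close>.\<close>

lemma expect_iid_mean_stick_diff_le:
  assumes p: "finite_law K v p" and q: "finite_law K v q" and v: "\<And>j. j \<le> K \<Longrightarrow> v j \<le> b"
    and match: "\<And>k. k \<le> L \<Longrightarrow> (\<Sum>j\<le>K. p j * v j ^ k) = (\<Sum>j\<le>K. q j * v j ^ k)"
    and g: "\<And>l. 0 \<le> g l \<and> g l \<le> 1"
  shows "\<bar>expect K v p V (\<lambda>x. iid_mean m {..V} (stick V x) g) -
          expect K v q V (\<lambda>x. iid_mean m {..V} (stick V x) g)\<bar>
      \<le> real V * exp (exp 1 * 2 * b * real m - (real L + 1))"
proof (rule expect_swap_law [OF p q])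
  fix x :: "nat \<Rightarrow> real" and i assume x: "x \<in> unit_vectors" and i: "i < V"
  interpret p: finite_law K v p by fact
  interpret q: finite_law K v q by fact
  define \<alpha> \<beta> where "\<alpha> = stick V (x(i := 0))" and "\<beta> s = stick V (x(i := 1)) s - stick V (x(i := 0)) s" for s
  have nn: "0 \<le> stick V (x(i := 0)) s" "0 \<le> stick V (x(i := 1)) s" for s
    using x by (auto intro!: stick_nonneg unit_vectors_update)
  have "(\<Sum>s\<le>V. \<bar>\<alpha> s\<bar>) \<le> 1"
    using nn sum_stick [of V "x(i := 0)"] by (simp add: \<alpha>_def)
  moreover have "(\<Sum>s\<le>V. \<bar>\<beta> s\<bar>) \<le> (\<Sum>s\<le>V. stick V (x(i := 1)) s + stick V (x(i := 0)) s)"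
    using nn by (intro sum_mono) (simp add: \<beta>_def abs_le_iff add_increasing add_increasing2)
  then have "(\<Sum>s\<le>V. \<bar>\<beta> s\<bar>) \<le> 2"
    by (simp add: sum.distrib sum_stick)
  moreover have "\<bar>g l\<bar> \<le> 1" for l using g [of l] by simp
  ultimately obtain P where P: "\<And>y. poly P y = iid_mean m {..V} (\<lambda>s. \<alpha> s + y * \<beta> s) g"
    and coeff_P: "\<And>k. \<bar>coeff P k\<bar> \<le> real (m choose k) * 2 ^ k"
    using iid_mean_affine_poly [of "{..V}" \<alpha> \<beta> 2 g m] by auto
  have "stick V (x(i := y)) = (\<lambda>s. \<alpha> s + y * \<beta> s)" for y
    unfolding \<alpha>_def \<beta>_def by (rule ext, rule stick_update [OF i])
  then have "poly P y = iid_mean m {..V} (stick V (x(i := y))) g" for y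
    by (simp add: P)
  moreover have "\<bar>(\<Sum>j\<in>{..K}. p j * poly P (v j)) - (\<Sum>j\<in>{..K}. q j * poly P (v j))\<bar>
      \<le> exp (exp 1 * 2 * b * real m - (real L + 1))"
    using p.v v p.nonneg p.sum_1 q.nonneg q.sum_1 match coeff_P
    by (intro moment_matching_poly_diff_le) auto
  ultimately show "\<bar>(\<Sum>j\<le>K. p j * iid_mean m {..V} (stick V (x(i := v j))) g) -
      (\<Sum>j\<le>K. q j * iid_mean m {..V} (stick V (x(i := v j))) g)\<bar>
      \<le> exp (exp 1 * 2 * b * real m - (real L + 1))"
    by simp
qed

text \<open>Under \<open>p\<close> few sites are expected to be nonzero, under \<open>q\<close> few
  are expected to differ from \<open>y\<close>, so the two promises force mean acceptance apart by
  more than 1 / 8, while the matching moments keep it within 1 / 8.\<close>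

lemma support_size_indistinguishable:
  fixes n m :: nat and g :: "nat list \<Rightarrow> real"
  assumes n: "n \<ge> 2" and m: "real m < real n / ln (real n)"
    and g: "\<And>l. 0 \<le> g l \<and> g l \<le> 1"
    and small: "\<And>x. x \<in> unit_vectors \<Longrightarrow> card {i. i < 8 * n \<and> x i \<noteq> 0} \<le> n \<Longrightarrow>
      2 / 3 \<le> iid_mean m {..8 * n} (stick (8 * n) x) g"
    and large: "\<And>x. x \<in> unit_vectors \<Longrightarrow> (\<Sum>i<8 * n. x i) \<le> 1 / 2 \<Longrightarrow>
      card {i. i < 8 * n \<and> x i \<noteq> 1 / 10 ^ 8 / real (8 * n)} \<le> n \<Longrightarrow>
      iid_mean m {..8 * n} (stick (8 * n) x) g \<le> 1 / 3"
  shows False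
proof -
  define V where "V = 8 * n"
  \<comment> \<open>The factor \<open>10 ^ 8\<close> absorbs the spread of the nodes, roughly
    \<open>10 ^ 6\<close> times the square of \<open>L\<close>: it makes \<open>real V * b\<close>
    at most that square over 96.\<close>
  define y :: real where "y = 1 / 10 ^ 8 / real V"
  \<comment> \<open>The exponent will be at most \<open>L / 2 - (L + 2)\<close>; this choice bounds
    it by \<open>- ln V - 3\<close>, which pays for \<open>V\<close> exchanges and leaves
    \<open>exp (- 3)\<close>.\<close>
  define L where "L = nat \<lceil>2 * ln (real V) + 2\<rceil>"
  define b where "b = y * (1 + 100 * (101 * real L + 1)\<^sup>2)"
  define acc where "acc x = iid_mean m {..V} (stick V x) g" for x
  have V: "real V \<ge> 16" using n by (simp add: V_def)
  have y: "y > 0" using V by (simp add: y_def)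
  have lnV: "ln (real V) \<ge> 0" using V by simp
  then have L_ge: "real L \<ge> 2 * ln (real V) + 2" and L_le: "real L \<le> 2 * ln (real V) + 3"
    unfolding L_def by linarith+
  then have L1: "real L \<ge> 1" using lnV by linarith
  have b_le: "real V * b \<le> (real L)\<^sup>2 * (1 / 96)"
  proof -
    have "(101 * real L + 1)\<^sup>2 \<le> (102 * real L)\<^sup>2"
      using L1 by (intro power_mono) auto
    moreover have "1 \<le> (real L)\<^sup>2" using L1 by simp
    ultimately have "1 + 100 * (101 * real L + 1)\<^sup>2 \<le> 1040401 * (real L)\<^sup>2"
      by (simp add: power_mult_distrib)
    then have "1 / 10 ^ 8 * (1 + 100 * (101 * real L + 1)\<^sup>2) \<le> 1 / 10 ^ 8 * (1040401 * (real L)\<^sup>2)"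
      by (intro mult_left_mono) auto
    also have "\<dots> \<le> (real L)\<^sup>2 * (1 / 96)" by simp
    finally have "1 / 10 ^ 8 * (1 + 100 * (101 * real L + 1)\<^sup>2) \<le> (real L)\<^sup>2 * (1 / 96)" .
    then show ?thesis using V by (simp add: b_def y_def)
  qed
  have L_sqrt: "(real L)\<^sup>2 \<le> 16 * real V"
  proof -
    \<comment> \<open>Writing \<open>2 * ln V\<close> as \<open>4 * ln (sqrt V)\<close> lets the
      linear bound on the logarithm give growth of order \<open>sqrt V\<close>, enough for
      \<open>b \<le> 1\<close>.\<close>
    have "ln (sqrt (real V)) \<le> sqrt (real V) - 1" using V by (intro ln_le_minus_one) auto
    then have "real L \<le> 4 * sqrt (real V)" using L_le V by (simp add: ln_sqrt)
    then have "(real L)\<^sup>2 \<le> (4 * sqrt (real V))\<^sup>2" by (intro power_mono) auto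
    then show ?thesis by (simp add: power_mult_distrib)
  qed
  have b1: "b \<le> 1"
  proof -
    have "real V * b \<le> real V * 1" using b_le L_sqrt V by linarith
    then show ?thesis using V by (simp only: mult_le_cancel_left_pos)
  qed
  have b0: "b \<ge> 0" using y by (simp add: b_def)
  have Lm: "real L * real m \<le> 8 * real V"
  proof -
    have ln2: "ln 2 \<le> ln (real n)" using n by simp
    have pos: "ln (real n) > 0" using n by simp
    have "ln (2 ^ 3 :: real) = 3 * ln 2" by (subst ln_realpow) simp_all
    moreover have "ln (real V) = ln (2 ^ 3 :: real) + ln (real n)"
      using n ln_mult_pos [of "2 ^ 3" "real n"] by (simp add: V_def)
    ultimately have "ln (real V) = 3 * ln 2 + ln (real n)" by simp
    \<comment> \<open>The additive terms are absorbed through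
      \<open>2 / 3 \<le> ln 2 \<le> ln n\<close>.\<close>
    then have "real L \<le> 13 * ln (real n)" using L_le ln2 ln2_ge_two_thirds by linarith
    then have "real L * real m \<le> 13 * ln (real n) * (real n / ln (real n))"
      using m pos by (intro mult_mono) auto
    also have "\<dots> = 13 * real n" using pos by simp
    finally show ?thesis by (simp add: V_def)
  qed
  have "L \<ge> 1" using L1 by simp
  obtain K :: nat and v p q :: "nat \<Rightarrow> real" where
    v: "\<forall>j\<le>K. 0 \<le> v j \<and> v j \<le> b"
    and p0: "\<forall>j\<le>K. 0 \<le> p j" and q0: "\<forall>j\<le>K. 0 \<le> q j"
    and p1: "(\<Sum>j\<le>K. p j) = 1" and q1: "(\<Sum>j\<le>K. q j) = 1"
    and match: "\<forall>k\<le>L + 1. (\<Sum>j\<le>K. p j * v j ^ k) = (\<Sum>j\<le>K. q j * v j ^ k)"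
    and p_nz: "(\<Sum>j\<le>K. p j * of_bool (v j \<noteq> 0)) \<le> 1 / 100"
    and q_ny: "(\<Sum>j\<le>K. q j * of_bool (v j \<noteq> y)) \<le> 1 / 101"
    and q_mean: "(\<Sum>j\<le>K. q j * v j) \<le> y"
    by (rule moment_matching_laws [OF \<open>L \<ge> 1\<close> y, folded b_def])
  have lp: "finite_law K v p" and lq: "finite_law K v q"
    using v b1 p0 p1 q0 q1 by (auto simp: finite_law_def intro: order_trans)
  interpret p: finite_law K v p by fact
  interpret q: finite_law K v q by fact
  have "\<bar>expect K v p V acc - expect K v q V acc\<bar> \<le> real V * exp (exp 1 * 2 * b * real m - (real (L + 1) + 1))"
    unfolding acc_def using v match by (intro expect_iid_mean_stick_diff_le [OF lp lq _ _ g]) auto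
  also have "\<dots> \<le> real V * exp (- ln (real V) - 3)"
  proof -
    have "exp 1 * 2 * b * real m * real V \<le> 3 * 2 * b * real m * real V"
      using b0 exp_le by (intro mult_right_mono) auto
    also have "\<dots> = 6 * real m * (real V * b)" by simp
    also have "\<dots> \<le> 6 * real m * ((real L)\<^sup>2 * (1 / 96))"
      using b_le by (intro mult_left_mono) auto
    also have "\<dots> = real L / 16 * (real L * real m)" by (simp add: power2_eq_square)
    also have "\<dots> \<le> real L / 16 * (8 * real V)" using Lm by (intro mult_left_mono) auto
    also have "\<dots> = real L / 2 * real V" by simp
    finally have "exp 1 * 2 * b * real m \<le> real L / 2"
      using V by (simp only: mult_le_cancel_right_pos)
    then show ?thesis using L_ge by (intro mult_left_mono) auto
  qed
  also have "\<dots> = 1 / exp 1 ^ 3"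
    using V by (simp add: exp_diff exp_minus exp_of_nat_mult [symmetric] field_simps)
  also have "\<dots> \<le> 1 / 2 ^ 3"
    using exp_ge_add_one_self [of "1 :: real"] by (intro divide_left_mono power_mono) auto
  finally have close: "\<bar>expect K v p V acc - expect K v q V acc\<bar> \<le> 1 / 8" by simp
  have acc: "0 \<le> acc x \<and> acc x \<le> 1" if "x \<in> unit_vectors" for x
    unfolding acc_def using that g by (intro iid_mean_bounds) (auto simp: sum_stick stick_nonneg)
  have card_eq: "real (card {i. i < V \<and> Q i}) = (\<Sum>i<V. of_bool (Q i))" for Q
    by (simp add: sum.If_cases Collect_conj_eq lessThan_def)
  \<comment> \<open>Markov's inequality in pointwise form: acceptance is at least 2 / 3 minus the
    number of nonzero sites over \<open>n + 1\<close>. Beyond \<open>n\<close> such sites this bound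
    is negative and holds trivially.\<close>
  have "2 / 3 + real V * (\<Sum>j\<le>K. p j * (- of_bool (v j \<noteq> 0) / (real n + 1))) \<le> expect K v p V acc"
  proof (subst p.expect_affine_sum [where g = "\<lambda>t. - of_bool (t \<noteq> 0) / (real n + 1)", symmetric], rule p.expect_mono)
    fix x :: "nat \<Rightarrow> real" assume x: "x \<in> unit_vectors"
    have s: "(\<Sum>i<V. - of_bool (x i \<noteq> 0) / (real n + 1)) = - real (card {i. i < V \<and> x i \<noteq> 0}) / (real n + 1)"
      by (simp only: card_eq sum_negf sum_divide_distrib [symmetric])
    show "2 / 3 + (\<Sum>i<V. - of_bool (x i \<noteq> 0) / (real n + 1)) \<le> acc x"
    proof (cases "card {i. i < V \<and> x i \<noteq> 0} \<le> n")
      case True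
      then have "2 / 3 \<le> acc x" using small x by (simp add: acc_def V_def)
      moreover have "- real (card {i. i < V \<and> x i \<noteq> 0}) / (real n + 1) \<le> 0" by simp
      ultimately show ?thesis unfolding s by linarith
    next
      case False
      then have "- real (card {i. i < V \<and> x i \<noteq> 0}) / (real n + 1) \<le> - 1" by (simp add: field_simps)
      then show ?thesis unfolding s using acc [OF x] by linarith
    qed
  qed
  moreover have "real V * (\<Sum>j\<le>K. p j * (- of_bool (v j \<noteq> 0) / (real n + 1))) \<ge> - (8 / 100)"
  proof -
    have e: "real V * (\<Sum>j\<le>K. p j * (- of_bool (v j \<noteq> 0) / (real n + 1))) =
        - (real V / (real n + 1) * (\<Sum>j\<le>K. p j * of_bool (v j \<noteq> 0)))"
      by (simp only: sum_distrib_left sum_negf [symmetric]) (simp add: sum_negf)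
    have "real V / (real n + 1) * (\<Sum>j\<le>K. p j * of_bool (v j \<noteq> 0)) \<le> 8 * (1 / 100)"
      using p0 p_nz by (intro mult_mono sum_nonneg) (auto simp: V_def field_simps)
    then show ?thesis unfolding e by simp
  qed
  \<comment> \<open>The same from above, with two possible failures: too many sites differ from
    \<open>y\<close>, or the coordinates sum to more than 1 / 2. Either one alone lifts the
    right-hand side above 1.\<close>
  moreover have "expect K v q V acc \<le>
      1 / 3 + real V * (\<Sum>j\<le>K. q j * (of_bool (v j \<noteq> y) / real n + 2 * v j))"
  proof (subst q.expect_affine_sum [where g = "\<lambda>t. of_bool (t \<noteq> y) / real n + 2 * t", symmetric], rule q.expect_mono)
    fix x :: "nat \<Rightarrow> real" assume x: "x \<in> unit_vectors"
    have s: "(\<Sum>i<V. of_bool (x i \<noteq> y) / real n + 2 * x i) =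
        real (card {i. i < V \<and> x i \<noteq> y}) / real n + 2 * (\<Sum>i<V. x i)"
      by (simp only: card_eq sum.distrib sum_divide_distrib [symmetric] sum_distrib_left)
    have nn: "real (card {i. i < V \<and> x i \<noteq> y}) / real n \<ge> 0" "(\<Sum>i<V. x i) \<ge> 0"
      using x by (auto simp: unit_vectors_def intro: sum_nonneg)
    show "acc x \<le> 1 / 3 + (\<Sum>i<V. of_bool (x i \<noteq> y) / real n + 2 * x i)"
    proof (cases "card {i. i < V \<and> x i \<noteq> y} \<le> n \<and> (\<Sum>i<V. x i) \<le> 1 / 2")
      case True
      then have "acc x \<le> 1 / 3" using large x by (simp add: acc_def V_def y_def)
      then show ?thesis unfolding s using nn by linarith
    next
      case False
      then have "real (card {i. i < V \<and> x i \<noteq> y}) / real n \<ge> 1 \<or> 2 * (\<Sum>i<V. x i) \<ge> 1"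
        using n by (auto simp: field_simps)
      then show ?thesis unfolding s using acc [OF x] nn by linarith
    qed
  qed
  moreover have "real V * (\<Sum>j\<le>K. q j * (of_bool (v j \<noteq> y) / real n + 2 * v j)) \<le> 8 / 101 + 2 / 10 ^ 8"
  proof -
    have "real V * (\<Sum>j\<le>K. q j * (of_bool (v j \<noteq> y) / real n + 2 * v j)) =
      real V / real n * (\<Sum>j\<le>K. q j * of_bool (v j \<noteq> y)) + 2 * real V * (\<Sum>j\<le>K. q j * v j)"
      unfolding sum_distrib_left sum.distrib [symmetric] by (intro sum.cong refl) (simp add: algebra_simps)
    also have "\<dots> \<le> 8 * (1 / 101) + 2 * real V * y"
      using q_ny q_mean n by (intro add_mono mult_left_mono) (auto simp: V_def)
    also have "\<dots> = 8 / 101 + 2 / 10 ^ 8" using V by (simp add: y_def)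
    finally show ?thesis .
  qed
  \<comment> \<open>The remaining gap \<open>1/3 - 8/100 - 8/101 - 2/10^8\<close> exceeds 1 /
    8.\<close>
  ultimately show False using close by simp
qed

section \<open>Halfspaces on the moment curve\<close>

definition moment_point :: "nat \<Rightarrow> nat \<Rightarrow> nat \<Rightarrow> real" where
  "moment_point n i = (\<lambda>k\<in>{1..n}. real i ^ k)"

text \<open>One function on the whole space, fixed whatever the distribution, so that answers to
  queries carry no information on the support.\<close>

definition alternating_label :: "nat \<Rightarrow> (nat \<Rightarrow> real) \<Rightarrow> int" where
  "alternating_label n = (\<lambda>x\<in>space (Rn n). if x \<in> moment_point n ` {i. odd i} then -1 else 1)"

lemma moment_point_in_space: "moment_point n i \<in> space (Rn n)"
  by (simp add: moment_point_def Rn_def space_PiM)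

lemma inj_moment_point:
  assumes "n \<ge> 1" shows "inj (moment_point n)"
proof (rule injI)
  fix i j assume "moment_point n i = moment_point n j"
  then have "moment_point n i 1 = moment_point n j 1" by simp
  then show "i = j" using assms by (simp add: moment_point_def)
qed

lemma singleton_in_sets_Rn: "x \<in> space (Rn n) \<Longrightarrow> {x} \<in> sets (Rn n)"
proof -
  assume x: "x \<in> space (Rn n)"
  then have "{x} = (\<Pi>\<^sub>E i\<in>{1..n}. {x i})"
    by (simp add: Rn_def space_PiM PiE_iff PiE_singleton)
  also have "\<dots> \<in> sets (Rn n)"
    unfolding Rn_def by (rule sets_PiM_I_finite) auto
  finally show ?thesis .
qed

lemma alternating_label_moment_point:
  "n \<ge> 1 \<Longrightarrow> alternating_label n (moment_point n i) = (-1) ^ i"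
  by (simp add: alternating_label_def moment_point_in_space inj_image_mem_iff [OF inj_moment_point])

lemma two_valued_in_labellings:
  assumes "A \<in> sets X" and "c \<in> {-1, 1}" and "d \<in> {-1, 1}"
  shows "(\<lambda>x\<in>space X. if x \<in> A then c else d) \<in> labellings X"
proof -
  have "(\<lambda>x. if x \<in> A then c else d) \<in> measurable X (count_space {-1, 1})"
    using assms by (intro measurable_If_set measurable_const) auto
  then have "(\<lambda>x\<in>space X. if x \<in> A then c else d) \<in> measurable X (count_space {-1, 1})"
    by (subst measurable_cong [where g = "\<lambda>x. if x \<in> A then c else d"]) auto
  then show ?thesis by (simp add: labellings_def)
qed

lemma alternating_label_in_labellings: "alternating_label n \<in> labellings (Rn n)"
  unfolding alternating_label_def
  by (rule two_valued_in_labellings, rule sets.countable)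
    (auto intro: singleton_in_sets_Rn moment_point_in_space)

lemma halfspace_in_labellings: "halfspace n w \<in> labellings (Rn n)"
proof -
  define A where "A = {x \<in> space (Rn n). 0 \<le> w 0 + (\<Sum>i=1..n. w i * x i)}"
  have "(\<lambda>x. w 0 + (\<Sum>i=1..n. w i * x i)) \<in> borel_measurable (Rn n)"
    unfolding Rn_def by measurable
  then have "A \<in> sets (Rn n)" unfolding A_def by measurable
  moreover have "halfspace n w = (\<lambda>x\<in>space (Rn n). if x \<in> A then 1 else -1)"
    by (auto simp: halfspace_def A_def sign_pm_def restrict_def fun_eq_iff)
  ultimately show ?thesis by (simp add: two_valued_in_labellings)
qed

section \<open>Halfspaces on the curve as signs of polynomials\<close>

lemma halfspace_moment_point:
  "halfspace n w (moment_point n i) = sign_pm (\<Sum>k\<le>n. w k * real i ^ k)"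
proof -
  have "{..n} = insert 0 {1..n}" by auto
  then show ?thesis
    by (simp add: halfspace_def moment_point_in_space) (simp add: moment_point_def)
qed

text \<open>Newton interpolation: a new node is met by adding a multiple of the product of linear
  factors at the old nodes, which leaves the old values alone.\<close>

lemma interpolating_poly:
  fixes I :: "'a::field set"
  assumes "finite I" and "card I \<le> Suc n"
  shows "\<exists>p. degree p \<le> n \<and> (\<forall>a\<in>I. poly p a = c a)"
  using assms
proof (induction I arbitrary: n rule: finite_induct)
  case (insert a I)
  show ?case
  proof (cases n)
    case 0
    then have "I = {}" using insert by auto
    then show ?thesis by (intro exI [of _ "[:c a:]"]) auto
  next
    case (Suc n')
    then obtain p where p: "degree p \<le> n'" "\<And>b. b \<in> I \<Longrightarrow> poly p b = c b"
      using insert by force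
    define r where "r = (\<Prod>b\<in>I. [:- b, 1:])"
    have "degree r \<le> card I"
      unfolding r_def using degree_prod_sum_le [of I "\<lambda>b. [:- b, 1:]"] insert by simp
    then have r: "degree r \<le> n" using insert by simp
    define q where "q = p + smult ((c a - poly p a) / poly r a) r"
    have "poly r a \<noteq> 0" using insert by (auto simp: r_def poly_prod)
    then have "poly q a = c a" by (simp add: q_def)
    moreover have "poly q b = c b" if "b \<in> I" for b
    proof -
      have "poly r b = 0" using insert that by (auto simp: r_def poly_prod)
      then show ?thesis using p that by (simp add: q_def)
    qed
    moreover have "degree q \<le> n"
      unfolding q_def using p Suc r by (intro degree_add_le order_trans [OF degree_smult_le]) auto
    ultimately show ?thesis by blast
  qed
qed (auto intro: exI [of _ 0])

lemma halfspace_interpolates: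
  assumes "finite I" and "card I \<le> Suc n"
  obtains w where "\<And>i. i \<in> I \<Longrightarrow> halfspace n w (moment_point n i) = (-1) ^ i"
proof -
  have "card (real ` I) \<le> Suc n" using assms card_image_le le_trans by blast
  \<comment> \<open>The floor recovers the index \<open>i\<close> from the real node, so that the
    prescribed value can be written as a function of the node.\<close>
  then obtain p where p: "degree p \<le> n" "\<And>i. i \<in> I \<Longrightarrow> poly p (real i) = (-1) ^ nat \<lfloor>real i\<rfloor>"
    using interpolating_poly [of "real ` I" n "\<lambda>t. (-1) ^ nat \<lfloor>t\<rfloor>"] assms by auto
  have "poly p t = (\<Sum>k\<le>n. coeff p k * t ^ k)" for t
    unfolding poly_altdef using p by (intro sum.mono_neutral_left) (auto simp: coeff_eq_0)
  then have "halfspace n (coeff p) (moment_point n i) = (-1) ^ i" if "i \<in> I" for i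
    using p that by (cases "even i") (auto simp: halfspace_moment_point sign_pm_def)
  then show ?thesis by (rule that)
qed

text \<open>Each sign change yields a root in \<open>[2 * j, 2 * j + 1]\<close>. These intervals are
  disjoint, so the roots are distinct roots of one polynomial of degree at most
  \<open>n\<close>.\<close>

lemma card_sign_changes_le:
  fixes n N :: nat
  shows "card {j. j < N \<and> halfspace n w (moment_point n (2 * j)) \<noteq> halfspace n w (moment_point n (2 * j + 1))} \<le> n"
    (is "card ?C \<le> n")
proof (cases "?C = {}")
  case False
  define p where "p = (\<Sum>k\<le>n. monom (w k) k)"
  have poly_p: "poly p t = (\<Sum>k\<le>n. w k * t ^ k)" for t
    by (simp add: p_def poly_sum poly_monom)
  have h: "halfspace n w (moment_point n i) = sign_pm (poly p (real i))" for i
    by (simp add: halfspace_moment_point poly_p)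
  have deg: "degree p \<le> n"
    unfolding p_def by (intro degree_sum_le) (auto intro: order_trans [OF degree_monom_le])
  \<comment> \<open>The zero polynomial has constant sign and would leave \<open>?C\<close>
    empty.\<close>
  have p0: "p \<noteq> 0" using False by (auto simp: h)
  have root: "\<exists>t. real (2 * j) \<le> t \<and> t \<le> real (2 * j + 1) \<and> poly p t = 0" if "j \<in> ?C" for j
  proof -
    have "continuous_on {real (2 * j)..real (2 * j + 1)} (poly p)" by (intro continuous_intros)
    then show ?thesis
      using that IVT' [of "poly p" "real (2 * j)" 0 "real (2 * j + 1)"]
        IVT2' [of "poly p" "real (2 * j + 1)" 0 "real (2 * j)"]
      by (auto simp: h sign_pm_def split: if_splits)
  qed
  define t where "t j = (SOME t. real (2 * j) \<le> t \<and> t \<le> real (2 * j + 1) \<and> poly p t = 0)" for j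
  have t: "real (2 * j) \<le> t j \<and> t j \<le> real (2 * j + 1) \<and> poly p (t j) = 0" if "j \<in> ?C" for j
    unfolding t_def by (rule someI_ex, rule root, rule that)
  have "inj_on t ?C"
  proof (rule inj_onI)
    fix i j assume "i \<in> ?C" "j \<in> ?C" "t i = t j"
    with t [of i] t [of j] have "real (2 * i) \<le> real (2 * j + 1)" "real (2 * j) \<le> real (2 * i + 1)"
      by linarith+
    then show "i = j" by linarith
  qed
  then have "card ?C \<le> card {x. poly p x = 0}"
    using t p0 by (intro card_inj_on_le poly_roots_finite) auto
  also have "\<dots> \<le> n" using card_poly_roots_bound [OF p0] deg by simp
  finally show ?thesis .
next
  case True
  show ?thesis by (simp only: True card.empty)
qed

text \<open>Of the \<open>4 * n\<close> pairs of neighbouring sites, at most \<open>n\<close>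
  contain a bad site and at most \<open>n\<close> see a sign change. On each remaining pair the
  halfspace is constant while the labels differ, so it errs once.\<close>

lemma card_halfspace_errors_ge:
  assumes "card {i. i < 8 * n \<and> bad i} \<le> n"
  shows "2 * n \<le> card {i. i < 8 * n \<and> halfspace n w (moment_point n i) \<noteq> (-1) ^ i \<and> \<not> bad i}"
    (is "_ \<le> card ?E")
proof -
  let ?h = "\<lambda>i. halfspace n w (moment_point n i)"
  define C where "C = {j. j < 4 * n \<and> ?h (2 * j) \<noteq> ?h (2 * j + 1)}"
  define B where "B = (\<lambda>i. i div 2) ` {i. i < 8 * n \<and> bad i}"
  have "card B \<le> n" unfolding B_def using assms by (intro order_trans [OF card_image_le]) auto
  moreover have "card C \<le> n" unfolding C_def by (rule card_sign_changes_le)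
  moreover have "card {..<4 * n} - card (B \<union> C) \<le> card ({..<4 * n} - (B \<union> C))"
    by (rule diff_card_le_card_Diff) (auto simp: B_def C_def)
  moreover have "card (B \<union> C) \<le> card B + card C" by (rule card_Un_le)
  ultimately have "2 * n \<le> card ({..<4 * n} - (B \<union> C))" by simp
  also have "\<dots> \<le> card ((\<lambda>i. i div 2) ` ?E)"
  proof (rule card_mono)
    show "{..<4 * n} - (B \<union> C) \<subseteq> (\<lambda>i. i div 2) ` ?E"
    proof
      fix j assume j: "j \<in> {..<4 * n} - (B \<union> C)"
      have nb: "\<not> bad i" if "i div 2 = j" for i
      proof
        assume "bad i"
        moreover have "i < 8 * n" using j that by auto
        ultimately show False using j that by (auto simp: B_def)
      qed
      have "?h (2 * j) = ?h (2 * j + 1)" using j by (auto simp: C_def)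
      then have "?h (2 * j) \<noteq> (-1) ^ (2 * j) \<or> ?h (2 * j + 1) \<noteq> (-1) ^ (2 * j + 1)" by auto
      then have "2 * j \<in> ?E \<or> 2 * j + 1 \<in> ?E" using j nb [of "2 * j"] nb [of "2 * j + 1"] by auto
      moreover have "j = (2 * j) div 2" "j = (2 * j + 1) div 2" by simp_all
      ultimately show "j \<in> (\<lambda>i. i div 2) ` ?E" by blast
    qed
  qed auto
  also have "\<dots> \<le> card ?E" by (rule card_image_le) auto
  finally show ?thesis .
qed

section \<open>Testers on discrete distributions\<close>

text \<open>Sequences through a point of weight 0 drop out of the sum; this lets labellings that
  agree only on the support be interchanged.\<close>

lemma iid_mean_cong:
  assumes "\<And>l. l \<in> sequences m S \<Longrightarrow> (\<And>x. x \<in> set l \<Longrightarrow> D x \<noteq> 0) \<Longrightarrow> g l = h l"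
  shows "iid_mean m S D g = iid_mean m S D h"
  unfolding iid_mean_def
proof (rule sum.cong [OF refl])
  fix l assume "l \<in> sequences m S"
  with assms show "(\<Prod>x\<leftarrow>l. D x) * g l = (\<Prod>x\<leftarrow>l. D x) * h l"
    by (cases "0 \<in> D ` set l") (force simp: prod_list_zero_iff)+
qed

lemma iid_mean_one: "sum D S = 1 \<Longrightarrow> iid_mean m S D (\<lambda>_. 1) = 1"
  by (induction m) (simp_all add: iid_mean_0 iid_mean_Suc)

lemma iid_mean_complement: "sum D S = 1 \<Longrightarrow> iid_mean m S D (\<lambda>l. 1 - g l) = 1 - iid_mean m S D g"
  using iid_mean_one [of D S m] by (simp add: iid_mean_def right_diff_distrib sum_subtractf)

section \<open>Finitely supported distributions and their samples\<close>

definition discrete_measure :: "'x measure \<Rightarrow> 'i set \<Rightarrow> ('i \<Rightarrow> 'x) \<Rightarrow> ('i \<Rightarrow> real) \<Rightarrow> 'x measure" where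
  "discrete_measure X I \<phi> d = distr (point_measure I (\<lambda>i. ennreal (d i))) X \<phi>"

text \<open>The restriction is there because the sample space of \<open>iid_samples\<close> consists
  of functions that are \<open>undefined\<close> outside \<open>{..<m}\<close>.\<close>

definition points :: "('i \<Rightarrow> 'x) \<Rightarrow> nat \<Rightarrow> 'i list \<Rightarrow> nat \<Rightarrow> 'x" where
  "points \<phi> m l = (\<lambda>t\<in>{..<m}. \<phi> (l ! t))"

lemma slice_in_sets:
  assumes "E \<in> sets (R \<Otimes>\<^sub>M N)"
  shows "{r \<in> space R. (r, y) \<in> E} \<in> sets R"
proof -
  have "{r \<in> space R. (r, y) \<in> E} = (\<lambda>r. (r, y)) -` E"
    using sets.sets_into_space [OF assms] by (auto simp: space_pair_measure)
  then show ?thesis using sets_Pair2 [OF assms] by simp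
qed

locale discrete_distribution =
  fixes X :: "'x measure" and I :: "'i set" and \<phi> :: "'i \<Rightarrow> 'x" and d :: "'i \<Rightarrow> real"
  assumes finite_I: "finite I" and inj_\<phi>: "inj_on \<phi> I"
    and \<phi>_space: "\<And>i. i \<in> I \<Longrightarrow> \<phi> i \<in> space X" and \<phi>_singleton: "\<And>i. i \<in> I \<Longrightarrow> {\<phi> i} \<in> sets X"
    and d_nonneg: "\<And>i. i \<in> I \<Longrightarrow> 0 \<le> d i" and sum_d: "sum d I = 1"
begin

abbreviation "D \<equiv> discrete_measure X I \<phi> d"

lemma sets_D: "sets D = sets X" and space_D: "space D = space X"
  by (simp_all add: discrete_measure_def)

lemma emeasure_D:
  assumes "A \<in> sets X"
  shows "emeasure D A = ennreal (\<Sum>i | i \<in> I \<and> \<phi> i \<in> A. d i)"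
proof -
  have "\<phi> -` A \<inter> space (point_measure I (\<lambda>i. ennreal (d i))) = {i. i \<in> I \<and> \<phi> i \<in> A}"
    by (auto simp: space_point_measure)
  then have "emeasure D A = (\<Sum>i | i \<in> I \<and> \<phi> i \<in> A. ennreal (d i))"
    using assms \<phi>_space finite_I
    by (simp add: discrete_measure_def emeasure_distr emeasure_point_measure_finite)
  then show ?thesis using d_nonneg by (subst (asm) sum_ennreal) auto
qed

lemma measure_D: "A \<in> sets X \<Longrightarrow> measure D A = (\<Sum>i | i \<in> I \<and> \<phi> i \<in> A. d i)"
  by (auto simp: measure_def emeasure_D intro!: enn2real_ennreal sum_nonneg d_nonneg)

lemma prob_space_D: "prob_space D"
proof
  have "{i \<in> I. \<phi> i \<in> space X} = I" using \<phi>_space by auto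
  then show "emeasure D (space D) = 1" by (simp add: space_D emeasure_D sum_d)
qed

lemma D_in_distributions: "D \<in> distributions X"
  by (simp add: distributions_def prob_space_D sets_D)

lemma inj_points: "inj_on (points \<phi> m) (sequences m I)"
proof (rule inj_onI)
  fix l l' assume l: "l \<in> sequences m I" "l' \<in> sequences m I" and eq: "points \<phi> m l = points \<phi> m l'"
  show "l = l'"
  proof (rule nth_equalityI)
    show "length l = length l'" using l by (simp add: sequences_def)
    fix t assume t: "t < length l"
    then have "t < m" using l by (simp add: sequences_def)
    then have "\<phi> (l ! t) = \<phi> (l' ! t)" using fun_cong [OF eq, of t] by (simp add: points_def)
    moreover have "l ! t \<in> I" "l' ! t \<in> I"
      using l t by (auto simp: sequences_def subset_iff)
    ultimately show "l ! t = l' ! t" using inj_\<phi> by (auto dest: inj_onD)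
  qed
qed

lemma points_singleton:
  assumes "l \<in> sequences m I"
  shows "{points \<phi> m l} \<in> sets (iid_samples m D)"
    and "measure (iid_samples m D) {points \<phi> m l} = (\<Prod>i\<leftarrow>l. d i)"
proof -
  interpret D: prob_space D by (rule prob_space_D)
  interpret P: finite_product_prob_space "\<lambda>_. D" "{..<m}" by standard auto
  have in_I: "l ! t \<in> I" if "t < m" for t using assms that by (auto simp: sequences_def subset_iff)
  have e: "{points \<phi> m l} = (\<Pi>\<^sub>E t\<in>{..<m}. {\<phi> (l ! t)})"
  proof -
    have "(\<Pi>\<^sub>E t\<in>{..<m}. {\<phi> (l ! t)}) = (\<Pi>\<^sub>E t\<in>{..<m}. {points \<phi> m l t})"
      by (intro PiE_cong) (simp add: points_def)
    also have "\<dots> = {points \<phi> m l}" by (rule PiE_singleton) (unfold points_def, rule restrict_extensional)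
    finally show ?thesis ..
  qed
  have s: "{\<phi> (l ! t)} \<in> sets D" if "t \<in> {..<m}" for t
    using in_I \<phi>_singleton that by (simp add: sets_D)
  show "{points \<phi> m l} \<in> sets (iid_samples m D)"
    unfolding e iid_samples_def using s by (intro sets_PiM_I_finite) auto
  have "measure (iid_samples m D) {points \<phi> m l} = (\<Prod>t<m. measure D {\<phi> (l ! t)})"
    unfolding e iid_samples_def using s by (rule P.prob_times)
  also have "\<dots> = (\<Prod>t<m. d (l ! t))"
  proof (rule prod.cong)
    fix t assume "t \<in> {..<m}"
    then have "{i \<in> I. \<phi> i \<in> {\<phi> (l ! t)}} = {l ! t}"
      using in_I inj_\<phi> by (auto dest: inj_onD)
    then show "measure D {\<phi> (l ! t)} = d (l ! t)"
      using \<phi>_singleton in_I \<open>t \<in> {..<m}\<close> by (subst measure_D) auto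
  qed simp
  also have "\<dots> = (\<Prod>i\<leftarrow>l. d i)"
    using assms by (simp add: prod.list_conv_set_nth sequences_def atLeast0LessThan)
  finally show "measure (iid_samples m D) {points \<phi> m l} = (\<Prod>i\<leftarrow>l. d i)" .
qed

lemma prob_space_iid_samples: "prob_space (iid_samples m D)"
  unfolding iid_samples_def by (intro prob_space_PiM prob_space_D)

text \<open>Almost every sample lies in the finite set \<open>\<Omega>\<close>. Up to a null set,
  \<open>E\<close> is therefore a finite disjoint union of rectangles, a slice of seeds times a
  single sample.\<close>

lemma measure_seed_samples:
  assumes R: "prob_space R" and E: "E \<in> sets (R \<Otimes>\<^sub>M iid_samples m D)"
  shows "measure (R \<Otimes>\<^sub>M iid_samples m D) E = iid_mean m I d (\<lambda>l. measure R {r \<in> space R. (r, points \<phi> m l) \<in> E})"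
proof -
  interpret R: prob_space R by fact
  interpret N: prob_space "iid_samples m D" by (rule prob_space_iid_samples)
  interpret RN: pair_prob_space R "iid_samples m D" ..
  have times: "measure (R \<Otimes>\<^sub>M iid_samples m D) (A \<times> B) = measure R A * measure (iid_samples m D) B"
    if "A \<in> sets R" "B \<in> sets (iid_samples m D)" for A B
    using that by (simp add: N.emeasure_pair_measure_Times measure_def enn2real_mult)
  define slice where "slice l = {r \<in> space R. (r, points \<phi> m l) \<in> E}" for l
  have slice: "slice l \<in> sets R" for l
    unfolding slice_def using E by (rule slice_in_sets)
  define \<Omega> where "\<Omega> = points \<phi> m ` sequences m I"
  have fin: "finite (sequences m I)" using finite_I by (rule finite_sequences)
  have \<Omega>: "\<Omega> \<in> sets (iid_samples m D)"
    using sets.finite_UN [OF fin points_singleton(1)] by (simp add: \<Omega>_def UNION_singleton_eq_range)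
  have "measure (iid_samples m D) \<Omega> = (\<Sum>\<omega>\<in>\<Omega>. measure (iid_samples m D) {\<omega>})"
    using fin points_singleton(1) by (intro N.finite_measure_eq_sum_singleton) (auto simp: \<Omega>_def)
  also have "\<dots> = (\<Sum>l\<in>sequences m I. \<Prod>i\<leftarrow>l. d i)"
    unfolding \<Omega>_def by (simp add: sum.reindex [OF inj_points] points_singleton(2))
  also have "\<dots> = 1" using iid_mean_one [OF sum_d, of m] by (simp add: iid_mean_def)
  finally have "measure (iid_samples m D) (space (iid_samples m D) - \<Omega>) = 0"
    using N.prob_compl [OF \<Omega>] by simp
  then have null: "measure (R \<Otimes>\<^sub>M iid_samples m D) (space R \<times> (space (iid_samples m D) - \<Omega>)) = 0"
    using \<Omega> by (subst times) auto
  have prod: "space R \<times> \<Omega> \<in> sets (R \<Otimes>\<^sub>M iid_samples m D)" using \<Omega> by auto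
  have "measure (R \<Otimes>\<^sub>M iid_samples m D) (E - space R \<times> \<Omega>)
      \<le> measure (R \<Otimes>\<^sub>M iid_samples m D) (space R \<times> (space (iid_samples m D) - \<Omega>))"
    using E \<Omega> sets.sets_into_space [OF E]
    by (intro RN.finite_measure_mono) (auto simp: space_pair_measure)
  then have "measure (R \<Otimes>\<^sub>M iid_samples m D) (E - space R \<times> \<Omega>) = 0"
    using null by (simp add: measure_le_0_iff)
  then have "measure (R \<Otimes>\<^sub>M iid_samples m D) E = measure (R \<Otimes>\<^sub>M iid_samples m D) (E \<inter> space R \<times> \<Omega>)"
    using RN.finite_measure_Diff' [OF E prod] by simp
  also have "E \<inter> space R \<times> \<Omega> = (\<Union>l\<in>sequences m I. slice l \<times> {points \<phi> m l})"
    by (auto simp: \<Omega>_def slice_def)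
  also have "measure (R \<Otimes>\<^sub>M iid_samples m D) \<dots> =
      (\<Sum>l\<in>sequences m I. measure (R \<Otimes>\<^sub>M iid_samples m D) (slice l \<times> {points \<phi> m l}))"
    using fin slice points_singleton(1)
    by (intro RN.finite_measure_finite_Union)
      (auto simp: disjoint_family_on_def inj_on_eq_iff [OF inj_points])
  also have "\<dots> = iid_mean m I d (\<lambda>l. measure R (slice l))"
    unfolding iid_mean_def using slice points_singleton
    by (intro sum.cong refl) (simp add: times mult.commute)
  finally show ?thesis by (simp add: slice_def)
qed
lemma disagreement_D:
  assumes f: "f \<in> labellings X" and h: "h \<in> labellings X"
  shows "disagreement D f h = (\<Sum>i | i \<in> I \<and> f (\<phi> i) \<noteq> h (\<phi> i). d i)"
proof -
  have val: "f x \<in> {-1, 1}" "h x \<in> {-1, 1}" if "x \<in> space X" for x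
    using f h that by (auto simp: labellings_def dest: measurable_space)
  define F H where "F c = f -` {c} \<inter> space X" and "H c = h -` {c} \<inter> space X" for c
  have "F c \<in> sets X" "H c \<in> sets X" if "c \<in> {-1, 1}" for c
    using f h that unfolding labellings_def F_def H_def by (auto intro: measurable_sets)
  \<comment> \<open>Both functions take only the values -1 and 1, so they differ exactly on the
    union of these two intersections of preimages.\<close>
  then have "F (-1) \<inter> H 1 \<union> F 1 \<inter> H (-1) \<in> sets X"
    by (intro sets.Un sets.Int) auto
  also have "F (-1) \<inter> H 1 \<union> F 1 \<inter> H (-1) = {x \<in> space X. f x \<noteq> h x}"
    using val by (fastforce simp: F_def H_def)
  finally have "{x \<in> space X. f x \<noteq> h x} \<in> sets X" .
  moreover have "{i. i \<in> I \<and> \<phi> i \<in> {x \<in> space X. f x \<noteq> h x}} = {i. i \<in> I \<and> f (\<phi> i) \<noteq> h (\<phi> i)}"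
    using \<phi>_space by auto
  ultimately show ?thesis by (simp add: disagreement_def space_D measure_D)
qed

lemma dist_class_eq_0:
  assumes "f \<in> labellings X" and "h \<in> labellings X" and "h \<in> H"
    and "\<And>i. i \<in> I \<Longrightarrow> d i \<noteq> 0 \<Longrightarrow> f (\<phi> i) = h (\<phi> i)"
  shows "dist_class D f H = 0"
proof (rule antisym)
  have "disagreement D f h = 0"
    using assms by (subst disagreement_D) (auto intro!: sum.neutral)
  moreover have "bdd_below (disagreement D f ` H)"
    by (intro bdd_belowI [of _ 0]) (auto simp: disagreement_def)
  ultimately show "dist_class D f H \<le> 0"
    unfolding dist_class_def using \<open>h \<in> H\<close> by (metis cINF_lower)
  show "0 \<le> dist_class D f H"
    unfolding dist_class_def using \<open>h \<in> H\<close> by (intro cINF_greatest) (auto simp: disagreement_def)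
qed

end

section \<open>Stick-breaking distributions on the moment curve\<close>

definition stick_measure :: "nat \<Rightarrow> (nat \<Rightarrow> real) \<Rightarrow> (nat \<Rightarrow> real) measure" where
  "stick_measure n x = discrete_measure (Rn n) {..8 * n} (moment_point n) (stick (8 * n) x)"

lemma stick_discrete_distribution:
  assumes "n \<ge> 1" and "x \<in> unit_vectors"
  shows "discrete_distribution (Rn n) {..8 * n} (moment_point n) (stick (8 * n) x)"
proof
  show "inj_on (moment_point n) {..8 * n}"
    using inj_moment_point [OF assms(1)] by (rule inj_on_subset) simp
qed (use assms in \<open>simp_all add: moment_point_in_space singleton_in_sets_Rn stick_nonneg sum_stick\<close>)

text \<open>The site \<open>8 * n\<close> holding the rest of the stick may add one atom, and
  \<open>n + 1\<close> atoms are just what interpolation can handle.\<close>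

lemma small_support_consistent:
  assumes "card {i. i < 8 * n \<and> x i \<noteq> 0} \<le> n"
  obtains w where "\<And>i. i \<le> 8 * n \<Longrightarrow> stick (8 * n) x i \<noteq> 0 \<Longrightarrow> halfspace n w (moment_point n i) = (-1) ^ i"
proof -
  have "{i. i \<le> 8 * n \<and> stick (8 * n) x i \<noteq> 0} \<subseteq> insert (8 * n) {i. i < 8 * n \<and> x i \<noteq> 0}"
    by (auto simp: stick_def)
  then have "card {i. i \<le> 8 * n \<and> stick (8 * n) x i \<noteq> 0} \<le> card (insert (8 * n) {i. i < 8 * n \<and> x i \<noteq> 0})"
    by (intro card_mono) auto
  also have "\<dots> \<le> Suc n" using assms by simp
  finally obtain w where "\<And>i. i \<in> {i. i \<le> 8 * n \<and> stick (8 * n) x i \<noteq> 0} \<Longrightarrow>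
      halfspace n w (moment_point n i) = (-1) ^ i"
    by (rule halfspace_interpolates [rotated]) auto
  then show ?thesis by (intro that) auto
qed

text \<open>A halfspace errs on at least \<open>2 * n\<close> sites with \<open>x i = y\<close>, and
  stick breaking leaves each of them at least half of \<open>y\<close>.\<close>

lemma many_equal_atoms_far:
  assumes n: "n \<ge> 1" and x: "x \<in> unit_vectors" and sum: "(\<Sum>i<8 * n. x i) \<le> 1 / 2"
    and card: "card {i. i < 8 * n \<and> x i \<noteq> y} \<le> n" and y: "y \<ge> 0"
  shows "real n * y \<le> dist_class (stick_measure n x) (alternating_label n) (halfspaces n)"
proof -
  interpret discrete_distribution "Rn n" "{..8 * n}" "moment_point n" "stick (8 * n) x"
    using n x by (rule stick_discrete_distribution)
  have "real n * y \<le> disagreement D (alternating_label n) (halfspace n w)" for w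
  proof -
    define E where "E = {i. i < 8 * n \<and> halfspace n w (moment_point n i) \<noteq> (-1) ^ i \<and> \<not> x i \<noteq> y}"
    have "2 * n \<le> card E" unfolding E_def using card by (rule card_halfspace_errors_ge)
    then have "real (2 * n) * (y / 2) \<le> real (card E) * (y / 2)"
      using y by (intro mult_right_mono) auto
    also have "\<dots> = (\<Sum>i\<in>E. y / 2)" by simp
    also have "\<dots> \<le> (\<Sum>i\<in>E. stick (8 * n) x i)"
      using stick_ge [OF x sum] by (intro sum_mono) (force simp: E_def)
    also have "\<dots> \<le> (\<Sum>i | i \<in> {..8 * n} \<and> alternating_label n (moment_point n i) \<noteq> halfspace n w (moment_point n i).
        stick (8 * n) x i)"
      using x n by (intro sum_mono2) (auto simp: E_def alternating_label_moment_point stick_nonneg)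
    also have "\<dots> = disagreement D (alternating_label n) (halfspace n w)"
      by (rule disagreement_D [symmetric]) (rule alternating_label_in_labellings halfspace_in_labellings)+
    finally show ?thesis by simp
  qed
  then show ?thesis
    unfolding dist_class_def halfspaces_def stick_measure_def by (intro cINF_greatest) auto
qed

text \<open>Translates the probability of a tester's event into a mean over sequences of sites;
  \<open>verdict\<close> has to describe \<open>Q\<close> only on sequences that can be drawn. The
  complementary bound serves the case where \<open>Q\<close> is rejection.\<close>

lemma stick_measure_verdict:
  assumes n: "n \<ge> 1" and x: "x \<in> unit_vectors" and R: "prob_space R"
    and Q: "2 / 3 \<le> measure (R \<Otimes>\<^sub>M iid_samples m (stick_measure n x))
      {\<omega> \<in> space (R \<Otimes>\<^sub>M iid_samples m (stick_measure n x)). Q \<omega>}"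
    and verdict: "\<And>r l. l \<in> sequences m {..8 * n} \<Longrightarrow> (\<And>i. i \<in> set l \<Longrightarrow> stick (8 * n) x i \<noteq> 0) \<Longrightarrow>
      Q (r, points (moment_point n) m l) = verdict r l"
  shows "2 / 3 \<le> iid_mean m {..8 * n} (stick (8 * n) x) (\<lambda>l. measure R {r \<in> space R. verdict r l})"
    and "1 / 3 \<ge> iid_mean m {..8 * n} (stick (8 * n) x) (\<lambda>l. measure R {r \<in> space R. \<not> verdict r l})"
proof -
  interpret discrete_distribution "Rn n" "{..8 * n}" "moment_point n" "stick (8 * n) x"
    using n x by (rule stick_discrete_distribution)
  interpret R: prob_space R by fact
  define E where "E = {\<omega> \<in> space (R \<Otimes>\<^sub>M iid_samples m D). Q \<omega>}"
  have Q': "2 / 3 \<le> measure (R \<Otimes>\<^sub>M iid_samples m D) E"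
    using Q by (simp add: E_def stick_measure_def)
  \<comment> \<open>A set outside the sigma-algebra has \<open>measure\<close> 0, so the positive
    lower bound already yields measurability.\<close>
  then have E: "E \<in> sets (R \<Otimes>\<^sub>M iid_samples m D)"
    using measure_notin_sets by fastforce
  have slice: "{r \<in> space R. (r, points (moment_point n) m l) \<in> E} = {r \<in> space R. verdict r l}"
    if "l \<in> sequences m {..8 * n}" "\<And>i. i \<in> set l \<Longrightarrow> stick (8 * n) x i \<noteq> 0" for l
  proof -
    have "points (moment_point n) m l \<in> space (iid_samples m D)"
      using sets.sets_into_space [OF points_singleton(1) [OF that(1)]] by simp
    then show ?thesis using verdict [OF that] by (auto simp: E_def space_pair_measure)
  qed
  have mean: "2 / 3 \<le> iid_mean m {..8 * n} (stick (8 * n) x)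
      (\<lambda>l. measure R {r \<in> space R. (r, points (moment_point n) m l) \<in> E})"
    using Q' unfolding measure_seed_samples [OF R E] .
  also have "\<dots> = iid_mean m {..8 * n} (stick (8 * n) x) (\<lambda>l. measure R {r \<in> space R. verdict r l})"
    by (rule iid_mean_cong) (simp add: slice)
  finally show "2 / 3 \<le> iid_mean m {..8 * n} (stick (8 * n) x) (\<lambda>l. measure R {r \<in> space R. verdict r l})" .
  have "iid_mean m {..8 * n} (stick (8 * n) x) (\<lambda>l. measure R {r \<in> space R. \<not> verdict r l}) =
    iid_mean m {..8 * n} (stick (8 * n) x)
      (\<lambda>l. 1 - measure R {r \<in> space R. (r, points (moment_point n) m l) \<in> E})"
  proof (rule iid_mean_cong)
    fix l assume l: "l \<in> sequences m {..8 * n}" "\<And>i. i \<in> set l \<Longrightarrow> stick (8 * n) x i \<noteq> 0"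
    have "{r \<in> space R. \<not> verdict r l} = space R - {r \<in> space R. verdict r l}" by auto
    also have "\<dots> = space R - {r \<in> space R. (r, points (moment_point n) m l) \<in> E}"
      by (simp only: slice [OF l])
    finally show "measure R {r \<in> space R. \<not> verdict r l} =
        1 - measure R {r \<in> space R. (r, points (moment_point n) m l) \<in> E}"
      using R.prob_compl [OF slice_in_sets [OF E]] by simp
  qed
  also have "\<dots> \<le> 1 / 3" using mean by (subst iid_mean_complement) (auto simp: sum_d)
  finally show "1 / 3 \<ge> iid_mean m {..8 * n} (stick (8 * n) x) (\<lambda>l. measure R {r \<in> space R. \<not> verdict r l})" .
qed

section \<open>Lower bounds for the two testing models\<close>

text \<open>The common core of both models. The event \<open>Q\<close> may change with the
  distribution and the labelling, but all events are described by the same \<open>verdict\<close> of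
  seed and sites, which then plays the estimator of support size.\<close>

lemma too_few_samples:
  fixes n m :: nat and verdict :: "real \<Rightarrow> nat list \<Rightarrow> bool"
  assumes n: "n \<ge> 2" and m: "real m < real n / ln (real n)" and R: "prob_space R"
    and consistent: "\<And>x w. x \<in> unit_vectors \<Longrightarrow>
      (\<And>i. i \<le> 8 * n \<Longrightarrow> stick (8 * n) x i \<noteq> 0 \<Longrightarrow> halfspace n w (moment_point n i) = (-1) ^ i) \<Longrightarrow>
      \<exists>Q. 2 / 3 \<le> measure (R \<Otimes>\<^sub>M iid_samples m (stick_measure n x))
              {\<omega> \<in> space (R \<Otimes>\<^sub>M iid_samples m (stick_measure n x)). Q \<omega>} \<and>
          (\<forall>r. \<forall>l\<in>sequences m {..8 * n}. (\<forall>i\<in>set l. stick (8 * n) x i \<noteq> 0) \<longrightarrow>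
              Q (r, points (moment_point n) m l) = verdict r l)"
    and far: "\<And>x. x \<in> unit_vectors \<Longrightarrow>
      1 / (8 * 10 ^ 8) \<le> dist_class (stick_measure n x) (alternating_label n) (halfspaces n) \<Longrightarrow>
      \<exists>Q. 2 / 3 \<le> measure (R \<Otimes>\<^sub>M iid_samples m (stick_measure n x))
              {\<omega> \<in> space (R \<Otimes>\<^sub>M iid_samples m (stick_measure n x)). Q \<omega>} \<and>
          (\<forall>r. \<forall>l\<in>sequences m {..8 * n}. (\<forall>i\<in>set l. stick (8 * n) x i \<noteq> 0) \<longrightarrow>
              Q (r, points (moment_point n) m l) = (\<not> verdict r l))"
  shows False
proof (rule support_size_indistinguishable [OF n m])
  interpret R: prob_space R by fact
  show "0 \<le> measure R {r \<in> space R. verdict r l} \<and> measure R {r \<in> space R. verdict r l} \<le> 1" for l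
    by simp
  fix x :: "nat \<Rightarrow> real" assume x: "x \<in> unit_vectors"
  show "2 / 3 \<le> iid_mean m {..8 * n} (stick (8 * n) x) (\<lambda>l. measure R {r \<in> space R. verdict r l})"
    if "card {i. i < 8 * n \<and> x i \<noteq> 0} \<le> n"
  proof -
    obtain w where "\<And>i. i \<le> 8 * n \<Longrightarrow> stick (8 * n) x i \<noteq> 0 \<Longrightarrow> halfspace n w (moment_point n i) = (-1) ^ i"
      using small_support_consistent [OF \<open>card _ \<le> n\<close>] by blast
    from consistent [OF x this] obtain Q where
      "2 / 3 \<le> measure (R \<Otimes>\<^sub>M iid_samples m (stick_measure n x))
              {\<omega> \<in> space (R \<Otimes>\<^sub>M iid_samples m (stick_measure n x)). Q \<omega>}"
      "\<forall>r. \<forall>l\<in>sequences m {..8 * n}. (\<forall>i\<in>set l. stick (8 * n) x i \<noteq> 0) \<longrightarrow>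
              Q (r, points (moment_point n) m l) = verdict r l" by blast
    then show ?thesis using n x R by (intro stick_measure_verdict(1)) auto
  qed
  show "iid_mean m {..8 * n} (stick (8 * n) x) (\<lambda>l. measure R {r \<in> space R. verdict r l}) \<le> 1 / 3"
    if sum: "(\<Sum>i<8 * n. x i) \<le> 1 / 2" and card: "card {i. i < 8 * n \<and> x i \<noteq> 1 / 10 ^ 8 / real (8 * n)} \<le> n"
  proof -
    \<comment> \<open>The factor \<open>n\<close> cancels against the atom size, which yields the
      absolute threshold \<open>1 / (8 * 10 ^ 8)\<close>.\<close>
    have "real n * (1 / 10 ^ 8 / real (8 * n)) \<le> dist_class (stick_measure n x) (alternating_label n) (halfspaces n)"
      using n by (intro many_equal_atoms_far [OF _ x sum card]) auto
    then have "1 / (8 * 10 ^ 8) \<le> dist_class (stick_measure n x) (alternating_label n) (halfspaces n)"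
      using n by simp
    from far [OF x this] obtain Q where
      Q: "2 / 3 \<le> measure (R \<Otimes>\<^sub>M iid_samples m (stick_measure n x))
              {\<omega> \<in> space (R \<Otimes>\<^sub>M iid_samples m (stick_measure n x)). Q \<omega>}"
      "\<forall>r. \<forall>l\<in>sequences m {..8 * n}. (\<forall>i\<in>set l. stick (8 * n) x i \<noteq> 0) \<longrightarrow>
              Q (r, points (moment_point n) m l) = (\<not> verdict r l)" by blast
    have "iid_mean m {..8 * n} (stick (8 * n) x) (\<lambda>l. measure R {r \<in> space R. \<not> \<not> verdict r l}) \<le> 1 / 3"
      by (rule stick_measure_verdict(2) [OF _ x R Q(1)]) (use n Q(2) in auto)
    then show ?thesis by simp
  qed
qed

text \<open>Acceptance is promised only for true members of the class, so the labelling is the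
  interpolating halfspace in the consistent case and the alternating one in the far case. On the
  sampled sites both give \<open>(-1) ^ i\<close>, hence the tester sees the same
  \<open>view\<close>.\<close>

lemma sample_tester_ge:
  assumes n: "n \<ge> 2" and \<epsilon>: "\<epsilon> \<le> 1 / (8 * 10 ^ 8)" and T: "sample_tester (Rn n) (halfspaces n) \<epsilon> m R A"
  shows "real n / ln (real n) \<le> real m"
proof (rule ccontr)
  assume "\<not> real n / ln (real n) \<le> real m"
  then have m: "real m < real n / ln (real n)" by simp
  have R: "prob_space R" using T by (simp add: sample_tester_def random_seeds_def)
  have D: "stick_measure n x \<in> distributions (Rn n)" if "x \<in> unit_vectors" for x
    using discrete_distribution.D_in_distributions [OF stick_discrete_distribution] n that
    by (simp add: stick_measure_def)
  define view where "view f s = map (\<lambda>i. (s i, f (s i))) [0..<m]" for f :: "(nat \<Rightarrow> real) \<Rightarrow> int" and s :: "nat \<Rightarrow> nat \<Rightarrow> real"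
  define verdict where "verdict r l = A r (map (\<lambda>i. (moment_point n i, (-1) ^ i)) l)" for r l
  have view: "view f (points (moment_point n) m l) = map (\<lambda>i. (moment_point n i, (-1) ^ i)) l"
    if "l \<in> sequences m {..8 * n}" "\<And>i. i \<in> set l \<Longrightarrow> f (moment_point n i) = (-1) ^ i" for l f
    using that by (intro nth_equalityI) (auto simp: view_def points_def sequences_def)
  show False
  proof (rule too_few_samples [OF n m R])
    fix x :: "nat \<Rightarrow> real" assume x: "x \<in> unit_vectors"
    show "\<exists>Q. 2 / 3 \<le> measure (R \<Otimes>\<^sub>M iid_samples m (stick_measure n x))
              {\<omega> \<in> space (R \<Otimes>\<^sub>M iid_samples m (stick_measure n x)). Q \<omega>} \<and>
          (\<forall>r. \<forall>l\<in>sequences m {..8 * n}. (\<forall>i\<in>set l. stick (8 * n) x i \<noteq> 0) \<longrightarrow>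
              Q (r, points (moment_point n) m l) = verdict r l)"
      if w: "\<And>i. i \<le> 8 * n \<Longrightarrow> stick (8 * n) x i \<noteq> 0 \<Longrightarrow> halfspace n w (moment_point n i) = (-1) ^ i" for w
    proof (intro exI conjI allI ballI impI)
      show "2 / 3 \<le> measure (R \<Otimes>\<^sub>M iid_samples m (stick_measure n x))
          {\<omega> \<in> space (R \<Otimes>\<^sub>M iid_samples m (stick_measure n x)).
            A (fst \<omega>) (view (halfspace n w) (snd \<omega>)) = True}"
        using T D [OF x] halfspace_in_labellings [of n w]
        unfolding sample_tester_def sample_verdict_prob_def view_def halfspaces_def by blast
      fix r l assume l: "l \<in> sequences m {..8 * n}" "\<forall>i\<in>set l. stick (8 * n) x i \<noteq> 0"
      then have "halfspace n w (moment_point n i) = (-1) ^ i" if "i \<in> set l" for i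
        using w that by (auto simp: sequences_def)
      then show "(A (fst (r, points (moment_point n) m l)) (view (halfspace n w) (snd (r, points (moment_point n) m l))) = True)
          = verdict r l"
        using view [OF l(1)] by (simp add: verdict_def)
    qed
    show "\<exists>Q. 2 / 3 \<le> measure (R \<Otimes>\<^sub>M iid_samples m (stick_measure n x))
              {\<omega> \<in> space (R \<Otimes>\<^sub>M iid_samples m (stick_measure n x)). Q \<omega>} \<and>
          (\<forall>r. \<forall>l\<in>sequences m {..8 * n}. (\<forall>i\<in>set l. stick (8 * n) x i \<noteq> 0) \<longrightarrow>
              Q (r, points (moment_point n) m l) = (\<not> verdict r l))"
      if far: "1 / (8 * 10 ^ 8) \<le> dist_class (stick_measure n x) (alternating_label n) (halfspaces n)"
    proof (intro exI conjI allI ballI impI)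
      have "\<epsilon> \<le> dist_class (stick_measure n x) (alternating_label n) (halfspaces n)"
        using \<epsilon> far by (rule order_trans)
      then show "2 / 3 \<le> measure (R \<Otimes>\<^sub>M iid_samples m (stick_measure n x))
          {\<omega> \<in> space (R \<Otimes>\<^sub>M iid_samples m (stick_measure n x)).
            A (fst \<omega>) (view (alternating_label n) (snd \<omega>)) = False}"
        using T D [OF x] alternating_label_in_labellings [of n]
        unfolding sample_tester_def sample_verdict_prob_def view_def by blast
      fix r l assume l: "l \<in> sequences m {..8 * n}"
      then show "(A (fst (r, points (moment_point n) m l)) (view (alternating_label n) (snd (r, points (moment_point n) m l))) = False)
          = (\<not> verdict r l)"
        using view [OF l] n by (simp add: verdict_def alternating_label_moment_point)
    qed
  qed
qed

text \<open>Acceptance is promised at distance 0, so the alternating labelling serves both cases.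
  Every query then has the same answer under all distributions, and the run depends on the seed and
  the samples alone.\<close>

lemma query_tester_ge:
  assumes n: "n \<ge> 2" and \<epsilon>: "\<epsilon> \<le> 1 / (8 * 10 ^ 8)" and T: "query_tester (Rn n) (halfspaces n) \<epsilon> q R A"
  shows "real n / ln (real n) \<le> real q"
proof (rule ccontr)
  assume "\<not> real n / ln (real n) \<le> real q"
  then have q: "real q < real n / ln (real n)" by simp
  have R: "prob_space R" using T by (simp add: query_tester_def random_seeds_def)
  have D: "stick_measure n x \<in> distributions (Rn n)" if "x \<in> unit_vectors" for x
    using discrete_distribution.D_in_distributions [OF stick_discrete_distribution] n that
    by (simp add: stick_measure_def)
  have verdict: "dist_class (stick_measure n x) (alternating_label n) (halfspaces n) = 0 \<Longrightarrow>
      2 / 3 \<le> query_verdict_prob q R A (stick_measure n x) (alternating_label n) True"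
    "dist_class (stick_measure n x) (alternating_label n) (halfspaces n) \<ge> \<epsilon> \<Longrightarrow>
      2 / 3 \<le> query_verdict_prob q R A (stick_measure n x) (alternating_label n) False"
    if "x \<in> unit_vectors" for x
    using T D [OF that] alternating_label_in_labellings [of n] unfolding query_tester_def by blast+
  show False
  proof (rule too_few_samples [OF n q R, where verdict = "\<lambda>r l. run (A r) (alternating_label n) (points (moment_point n) q l) 0"])
    fix x :: "nat \<Rightarrow> real" assume x: "x \<in> unit_vectors"
    interpret discrete_distribution "Rn n" "{..8 * n}" "moment_point n" "stick (8 * n) x"
      using n x by (intro stick_discrete_distribution) auto
    show "\<exists>Q. 2 / 3 \<le> measure (R \<Otimes>\<^sub>M iid_samples q (stick_measure n x))
              {\<omega> \<in> space (R \<Otimes>\<^sub>M iid_samples q (stick_measure n x)). Q \<omega>} \<and>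
          (\<forall>r. \<forall>l\<in>sequences q {..8 * n}. (\<forall>i\<in>set l. stick (8 * n) x i \<noteq> 0) \<longrightarrow>
              Q (r, points (moment_point n) q l) = run (A r) (alternating_label n) (points (moment_point n) q l) 0)"
      if w: "\<And>i. i \<le> 8 * n \<Longrightarrow> stick (8 * n) x i \<noteq> 0 \<Longrightarrow> halfspace n w (moment_point n i) = (-1) ^ i" for w
    proof (intro exI conjI allI ballI impI)
      have "dist_class (stick_measure n x) (alternating_label n) (halfspaces n) = 0"
        unfolding stick_measure_def
        by (rule dist_class_eq_0 [OF alternating_label_in_labellings halfspace_in_labellings [of n w]])
          (use w n in \<open>auto simp: halfspaces_def alternating_label_moment_point\<close>)
      then show "2 / 3 \<le> measure (R \<Otimes>\<^sub>M iid_samples q (stick_measure n x))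
          {\<omega> \<in> space (R \<Otimes>\<^sub>M iid_samples q (stick_measure n x)). run (A (fst \<omega>)) (alternating_label n) (snd \<omega>) 0 = True}"
        using verdict(1) [OF x] unfolding query_verdict_prob_def by blast
    qed simp
    show "\<exists>Q. 2 / 3 \<le> measure (R \<Otimes>\<^sub>M iid_samples q (stick_measure n x))
              {\<omega> \<in> space (R \<Otimes>\<^sub>M iid_samples q (stick_measure n x)). Q \<omega>} \<and>
          (\<forall>r. \<forall>l\<in>sequences q {..8 * n}. (\<forall>i\<in>set l. stick (8 * n) x i \<noteq> 0) \<longrightarrow>
              Q (r, points (moment_point n) q l) = (\<not> run (A r) (alternating_label n) (points (moment_point n) q l) 0))"
      if far: "1 / (8 * 10 ^ 8) \<le> dist_class (stick_measure n x) (alternating_label n) (halfspaces n)"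
    proof (intro exI conjI allI ballI impI)
      show "2 / 3 \<le> measure (R \<Otimes>\<^sub>M iid_samples q (stick_measure n x))
          {\<omega> \<in> space (R \<Otimes>\<^sub>M iid_samples q (stick_measure n x)). run (A (fst \<omega>)) (alternating_label n) (snd \<omega>) 0 = False}"
        using verdict(2) [OF x order_trans [OF \<epsilon> far]] unfolding query_verdict_prob_def .
    qed simp
  qed
qed

text \<open>Rounding \<open>c\<close> up to a natural number moves the comparison into
  \<open>enat\<close>, where the infimum is formed; for empty \<open>S\<close> that infimum is
  \<infinity>.\<close>

lemma ereal_of_enat_INF_ge:
  assumes "\<And>m. m \<in> S \<Longrightarrow> c \<le> real m"
  shows "ereal c \<le> ereal_of_enat (INF m\<in>S. enat m)"
proof -
  have "enat (nat \<lceil>c\<rceil>) \<le> (INF m\<in>S. enat m)"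
    using assms by (intro INF_greatest) (auto simp: nat_le_iff ceiling_le_iff)
  then have "ereal_of_enat (enat (nat \<lceil>c\<rceil>)) \<le> ereal_of_enat (INF m\<in>S. enat m)"
    by (simp only: ereal_of_enat_le_iff)
  moreover have "c \<le> real (nat \<lceil>c\<rceil>)" by linarith
  ultimately show ?thesis by (simp add: order_trans [of _ "ereal (real (nat \<lceil>c\<rceil>))"])
qed

theorem theorem3p4:
  shows "\<exists>\<epsilon>\<^sub>0 c :: real. \<epsilon>\<^sub>0 > 0 \<and> c > 0 \<and>
    (\<forall>\<epsilon> :: real. \<forall>n :: nat. 0 < \<epsilon> \<longrightarrow> \<epsilon> < \<epsilon>\<^sub>0 \<longrightarrow> n \<ge> 2 \<longrightarrow>
       ereal_of_enat (m_test (Rn n) (halfspaces n) \<epsilon>) \<ge> ereal (c * (real n / ln (real n))) \<and>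
       ereal_of_enat (q_test0 (Rn n) (halfspaces n) \<epsilon>) \<ge> ereal (c * (real n / ln (real n))))"
proof (intro exI conjI allI impI)
  \<comment> \<open>The threshold is \<open>n\<close> times the atom parameter
    \<open>1 / 10 ^ 8 / (8 * n)\<close>; the bounds for both testers hold with constant 1.\<close>
  show "(1 / (8 * 10 ^ 8) :: real) > 0" "(1 :: real) > 0" by simp_all
  fix \<epsilon> :: real and n :: nat
  assume \<epsilon>: "\<epsilon> < 1 / (8 * 10 ^ 8)" and n: "n \<ge> 2"
  show "ereal_of_enat (m_test (Rn n) (halfspaces n) \<epsilon>) \<ge> ereal (1 * (real n / ln (real n)))"
    and "ereal_of_enat (q_test0 (Rn n) (halfspaces n) \<epsilon>) \<ge> ereal (1 * (real n / ln (real n)))"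
    unfolding m_test_def q_test0_def
    using sample_tester_ge [OF n less_imp_le [OF \<epsilon>]] query_tester_ge [OF n less_imp_le [OF \<epsilon>]]
    by (auto intro!: ereal_of_enat_INF_ge)
qed

end
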